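(* There exist constants $c_0,c_1,c_2>0$ such that for all integers $k\ge 2$ and $d\ge 2$ with $d\ge c_0\log k$, \[ \frac{1}{k}\left(1+\frac{c_1}{\sqrt{d}}\right)\le \gamma_{k,d}\le \frac{1}{k}\left(1+c_2\sqrt{\frac{\log k}{d}}\right). \]
   Context: $\log$ denotes the logarithm base 2. For integers $k\ge 2$ and $n\ge 1$ let $[k]=\{1,\dots,k\}$. A subsequence of a string is obtained by deleting zero or more of its characters. For strings $X^1,\dots,X^d$, $\mathrm{LCS}(X^1,\dots,X^d)$ denotes the length of a longest string that is a subsequence of every $X^i$. The generalized Chvátal–Sankoff constant is \[ \gamma_{k,d}=\lim_{n\to\infty}\frac{\mathbb{E}[\mathrm{LCS}(X^1,\dots,X^d)]}{n}, \] where $X^1,\dots,X^d$ are independent uniformly random strings in $[k]^n$ (this limit exists). *)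

theory Defs
  imports "HOL-Probability.Probability" "HOL-Probability.Product_PMF" "HOL-Library.Sublist"
begin

definition strings :: "nat \<Rightarrow> nat \<Rightarrow> nat list set" where
  "strings k n = {x. set x \<subseteq> {1..k} \<and> length x = n}"

(* Only meaningful for nonempty I: otherwise the lengths are unbounded and Max is unspecified. *)
definition LCS :: "'i set \<Rightarrow> ('i \<Rightarrow> 'a list) \<Rightarrow> nat" where
  "LCS I X = Max {length w | w. \<forall>i\<in>I. subseq w (X i)}"

(* Pi_pmf is the product distribution, so the strings X i with i < d are independent;
   the default value [] is taken only at indices i \<ge> d, which play no role. *)
definition random_strings :: "nat \<Rightarrow> nat \<Rightarrow> nat \<Rightarrow> (nat \<Rightarrow> nat list) pmf" where
  "random_strings k d n = Pi_pmf {..<d} [] (\<lambda>_. pmf_of_set (strings k n))"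

definition expected_LCS :: "nat \<Rightarrow> nat \<Rightarrow> nat \<Rightarrow> real" where
  "expected_LCS k d n =
     measure_pmf.expectation (random_strings k d n) (\<lambda>X. real (LCS {..<d} X))"

(* The generalized Chvatal-Sankoff constant. The sequence converges for k, d \<ge> 1, since
   expected_LCS k d is superadditive in n and bounded by n. *)
definition chvatal_sankoff :: "nat \<Rightarrow> nat \<Rightarrow> real" where
  "chvatal_sankoff k d = lim (\<lambda>n. expected_LCS k d n / real n)"

end

theory Submission
  imports Defs
begin

text \<open>
  Upper bound. A fixed word \<open>w\<close> of length \<open>m\<close> is a subsequence of a uniform string in \<open>[k]\<^sup>n\<close> with the
  probability that a binomial \<open>(n, 1/k)\<close> variable is at least \<open>m\<close>, so by Chernoff and a union bound over the
  \<open>k\<^sup>m\<close> words, a common subsequence of length \<open>m = (1 + \<epsilon>) n / k\<close> is exponentially unlikely as soon as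
  \<open>d \<epsilon>\<^sup>2\<close> exceeds a constant times \<open>log k\<close>.

  Lower bound. Build a common subsequence greedily. In each round every string skips to its first letter
  from \<open>{1, 2}\<close>, the majority letter among these \<open>d\<close> letters is appended to the word, and the strings
  that disagree skip past their next occurrence of it. A string uses \<open>k/2\<close> letters on average, plus \<open>k\<close>
  if it disagrees. A random sign agrees with the majority of \<open>d\<close> random signs with probability at least
  \<open>1/2 + c/\<surd>d\<close>, so the mean cost per round is at most \<open>k (1 - c/\<surd>d)\<close>. An exponential moment bound
  shows that all strings stay close to their mean cost.
\<close>

subsection \<open>Longest common subsequences\<close>

definition has_common_subseq :: "nat \<Rightarrow> 'i set \<Rightarrow> ('i \<Rightarrow> 'a list) \<Rightarrow> bool" where
  "has_common_subseq m I X \<longleftrightarrow> (\<exists>w. length w = m \<and> (\<forall>i\<in>I. subseq w (X i)))"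

lemma finite_common_subseq_lengths:
  assumes "i \<in> I"
  shows "finite {length w | w. \<forall>i\<in>I. subseq w (X i)}"
  by (rule finite_subset[of _ "{..length (X i)}"])
     (use assms in \<open>auto dest: list_emb_length\<close>)

text \<open>A prefix of a common subsequence is again one, so the attainable lengths are closed
  downwards and asking for the exact length \<open>m\<close> suffices.\<close>

lemma le_LCS_iff:
  assumes "I \<noteq> {}"
  shows "m \<le> LCS I X \<longleftrightarrow> has_common_subseq m I X"
proof -
  let ?S = "{length w | w. \<forall>i\<in>I. subseq w (X i)}"
  obtain i where "i \<in> I" using assms by auto
  then have fin: "finite ?S"
    by (rule finite_common_subseq_lengths)
  have "length [] \<in> ?S"
    by (intro CollectI exI[of _ "[]"]) simp
  then have ne: "?S \<noteq> {}"
    by fast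
  have "m \<le> LCS I X \<longleftrightarrow> (\<exists>l\<in>?S. m \<le> l)"
    unfolding LCS_def using Max_ge_iff[OF fin ne] .
  also have "\<dots> \<longleftrightarrow> has_common_subseq m I X"
  proof
    assume "\<exists>l\<in>?S. m \<le> l"
    then obtain w where w: "\<forall>i\<in>I. subseq w (X i)" "m \<le> length w"
      by auto
    have "subseq (take m w) (X i)" if "i \<in> I" for i
      using w that by (meson prefix_imp_subseq subseq_order.trans take_is_prefix)
    with w show "has_common_subseq m I X"
      unfolding has_common_subseq_def by (intro exI[of _ "take m w"]) auto
  qed (auto simp: has_common_subseq_def)
  finally show ?thesis .
qed

lemma has_common_subseq_append:
  assumes "has_common_subseq m I X" "has_common_subseq n I Y"
  shows "has_common_subseq (m + n) I (\<lambda>i. X i @ Y i)"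
proof -
  obtain v w where v: "length v = m" "\<forall>i\<in>I. subseq v (X i)"
      and w: "length w = n" "\<forall>i\<in>I. subseq w (Y i)"
    using assms unfolding has_common_subseq_def by blast
  have "subseq (v @ w) (X i @ Y i)" if "i \<in> I" for i
    using v w that by (auto intro: list_emb_append_mono)
  then show ?thesis
    unfolding has_common_subseq_def using v w by (intro exI[of _ "v @ w"]) auto
qed

text \<open>One greedy move: every string may skip a prefix \<open>u\<close> of its own, but all of
  them stop at the same letter \<open>a\<close>.\<close>

lemma has_common_subseq_step:
  assumes "has_common_subseq m I Y" and "\<And>i. i \<in> I \<Longrightarrow> \<exists>u. X i = u @ a # Y i"
  shows "has_common_subseq (Suc m) I X"
proof -
  obtain w where w: "length w = m" "\<forall>i\<in>I. subseq w (Y i)"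
    using assms(1) unfolding has_common_subseq_def by blast
  have "subseq (a # w) (X i)" if "i \<in> I" for i
  proof -
    obtain u where "X i = u @ a # Y i" using assms(2)[OF \<open>i \<in> I\<close>] by auto
    then show ?thesis using w that by (simp add: list_emb_append2)
  qed
  then show ?thesis
    unfolding has_common_subseq_def using w by (intro exI[of _ "a # w"]) auto
qed

lemma LCS_append:
  assumes "I \<noteq> {}"
  shows "LCS I X + LCS I Y \<le> LCS I (\<lambda>i. X i @ Y i)"
  using assms le_LCS_iff[OF assms] has_common_subseq_append by blast

lemma LCS_cong:
  assumes "\<And>i. i \<in> I \<Longrightarrow> X i = Y i"
  shows "LCS I X = LCS I Y"
  using assms by (simp add: LCS_def)

lemma LCS_le_length:
  assumes "i \<in> I"
  shows "LCS I X \<le> length (X i)"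
proof -
  have "has_common_subseq (LCS I X) I X"
    using assms le_LCS_iff[of I "LCS I X" X] by auto
  then show ?thesis
    using assms unfolding has_common_subseq_def by (metis list_emb_length)
qed

subsection \<open>Uniform random strings\<close>

lemma finite_strings: "finite (strings k n)"
  unfolding strings_def by (rule finite_lists_length_eq) simp

lemma card_strings: "card (strings k n) = k ^ n"
  unfolding strings_def by (subst card_lists_length_eq) simp_all

lemma strings_nonempty: "k > 0 \<Longrightarrow> strings k n \<noteq> {}"
  by (metis card.empty card_strings not_less_zero power_not_zero less_not_refl)

lemma strings_0: "strings k 0 = {[]}"
  by (auto simp: strings_def)

lemma strings_Suc: "strings k (Suc n) = (\<lambda>(a, x). a # x) ` ({1..k} \<times> strings k n)"
  by (auto simp: strings_def length_Suc_conv image_iff)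

abbreviation random_string :: "nat \<Rightarrow> nat \<Rightarrow> nat list pmf" where
  "random_string k n \<equiv> pmf_of_set (strings k n)"

lemma set_random_string: "k > 0 \<Longrightarrow> set_pmf (random_string k n) = strings k n"
  by (simp add: set_pmf_of_set finite_strings strings_nonempty)

lemma random_string_0: "random_string k 0 = return_pmf []"
  by (simp add: strings_0 pmf_of_set_singleton)

lemma random_string_Suc:
  assumes "k > 0"
  shows "random_string k (Suc n) =
    bind_pmf (pmf_of_set {1..k}) (\<lambda>a. map_pmf (Cons a) (random_string k n))"
proof -
  have "map_pmf (\<lambda>(a, x). a # x) (pmf_of_set ({1..k} \<times> strings k n)) = random_string k (Suc n)"
    unfolding strings_Suc using assms strings_nonempty[OF assms]
    by (intro map_pmf_of_set_inj) (auto simp: inj_on_def finite_strings)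
  moreover have "pmf_of_set ({1..k} \<times> strings k n) = pair_pmf (pmf_of_set {1..k}) (random_string k n)"
    using assms strings_nonempty[OF assms]
    by (intro pmf_eqI) (auto simp: pmf_pair finite_strings indicator_def pmf_of_set)
  ultimately show ?thesis
    by (simp add: pair_pmf_def map_bind_pmf map_pmf_def bind_assoc_pmf bind_return_pmf)
qed

lemma random_string_add:
  assumes "k > 0"
  shows "random_string k (m + n) =
    bind_pmf (random_string k m) (\<lambda>x. map_pmf (append x) (random_string k n))"
proof (induction m)
  case 0
  have "append [] = (id :: nat list \<Rightarrow> nat list)"
    by (auto simp: fun_eq_iff)
  then show ?case by (simp add: random_string_0 bind_return_pmf)
next
  case (Suc m)
  then show ?case
    using assms
    by (simp add: random_string_Suc map_pmf_def bind_assoc_pmf bind_return_pmf)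
qed

subsection \<open>Superadditivity\<close>

text \<open>Fekete's lemma; the limit is the supremum of the ratios. Nonnegativity lets the last
  incomplete block be discarded.\<close>

lemma superadditive_ratio_convergent:
  fixes a :: "nat \<Rightarrow> real"
  assumes super: "\<And>m n. a m + a n \<le> a (m + n)"
    and nonneg: "\<And>n. 0 \<le> a n" and bound: "\<And>n. a n \<le> c * real n"
  shows "convergent (\<lambda>n. a n / real n)"
proof -
  let ?S = "(\<lambda>n. a n / real n) ` {1..}"
  have bdd: "bdd_above ?S"
  proof (rule bdd_aboveI2)
    fix n :: nat assume "n \<in> {1..}"
    then show "a n / real n \<le> c" using bound[of n] by (simp add: divide_le_eq mult.commute)
  qed
  have mult: "real q * a m \<le> a (q * m)" for q m
  proof (induction q)
    case 0 then show ?case using nonneg by simp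
  next
    case (Suc q)
    then show ?case using super[of m "q * m"] by (simp add: algebra_simps)
  qed
  have "(\<lambda>n. a n / real n) \<longlonglongrightarrow> Sup ?S"
  proof (rule order_tendstoI)
    fix y assume "y < Sup ?S"
    then obtain m where m: "m \<ge> 1" "y < a m / real m"
      using less_cSup_iff[OF _ bdd] by auto
    \<comment> \<open>Cutting \<open>n\<close> into \<open>n div m\<close> blocks, which is at least
      \<open>n / m - 1\<close>, bounds \<open>a n / n\<close> below by
      \<open>a m / m - a m / n\<close>. So it is enough that this expression eventually exceeds
      \<open>y\<close>.\<close>
    have "(\<lambda>n. a m / real m - a m / real n) \<longlonglongrightarrow> a m / real m - 0"
      by (intro tendsto_intros lim_const_over_n)
    then have "eventually (\<lambda>n. y < a m / real m - a m / real n) sequentially"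
      using m by (intro order_tendstoD(1)[where a = y]) auto
    then show "eventually (\<lambda>n. y < a n / real n) sequentially"
      using eventually_gt_at_top[of 0]
    proof eventually_elim
      case (elim n)
      define q where "q = n div m"
      have "real n \<le> real ((q + 1) * m)"
        using m by (simp only: of_nat_le_iff q_def)
          (metis add.commute add_mult_distrib dividend_less_div_times less_imp_le mult_1 less_le_trans zero_less_one)
      then have q: "real n \<le> (real q + 1) * real m" by (simp add: algebra_simps)
      have "n = q * m + n mod m" by (simp add: q_def)
      then have "real q * a m \<le> a n"
        using mult[of q m] super[of "q * m" "n mod m"] nonneg[of "n mod m"] by simp
      moreover have "(real n / real m - 1) * a m \<le> real q * a m"
        using q m nonneg[of m] by (intro mult_right_mono) (simp_all add: field_simps)
      ultimately have "(real n / real m - 1) * a m \<le> a n" by linarith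
      then have "(real n / real m - 1) * a m / real n \<le> a n / real n"
        by (rule divide_right_mono) simp
      moreover have "(real n / real m - 1) * a m / real n = a m / real m - a m / real n"
        using elim m by (simp add: field_simps)
      ultimately show ?case using elim by linarith
    qed
  next
    fix y assume y: "Sup ?S < y"
    show "eventually (\<lambda>n. a n / real n < y) sequentially"
      using eventually_ge_at_top[of 1]
    proof eventually_elim
      case (elim n)
      then have "a n / real n \<le> Sup ?S"
        by (intro cSup_upper bdd) auto
      with y show ?case by linarith
    qed
  qed
  then show ?thesis by (rule convergentI)
qed

section \<open>Superadditivity of the expected LCS and existence of the limit\<close>

lemma random_strings_support:
  assumes "k > 0" "X \<in> set_pmf (random_strings k d n)"
  shows "\<forall>i<d. X i \<in> strings k n"
  using assms by (auto simp: random_strings_def set_Pi_pmf PiE_dflt_def set_random_string)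

lemma finite_support_random_strings:
  assumes "k > 0"
  shows "finite (set_pmf (random_strings k d n))"
  unfolding random_strings_def using assms
  by (auto simp: set_Pi_pmf set_random_string finite_strings intro!: finite_PiE_dflt)

text \<open>Cutting every string after \<open>m\<close> letters gives two independent tuples. This
  coupling puts the three expectations of the superadditivity proof on one probability
  space.\<close>

lemma random_strings_add:
  assumes "k > 0"
  shows "random_strings k d (m + n) =
    map_pmf (\<lambda>(X, Y) i. if i < d then X i @ Y i else [])
      (pair_pmf (random_strings k d m) (random_strings k d n))"
proof -
  have "random_strings k d (m + n) = Pi_pmf {..<d} []
      (\<lambda>_. bind_pmf (random_string k m) (\<lambda>x. bind_pmf (random_string k n) (\<lambda>y. return_pmf (x @ y))))"
    unfolding random_strings_def random_string_add[OF assms] map_pmf_def ..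
  also have "\<dots> = bind_pmf (random_strings k d m) (\<lambda>X. bind_pmf (random_strings k d n)
      (\<lambda>Y. return_pmf (\<lambda>i. if i < d then X i @ Y i else [])))"
    unfolding random_strings_def
    by (subst Pi_pmf_bind[where d' = "[]"], simp, subst Pi_pmf_bind[where d' = "[]"], simp) simp
  finally show ?thesis
    by (simp add: pair_pmf_def map_pmf_def bind_assoc_pmf bind_return_pmf)
qed

lemma LCS_random_strings_le:
  assumes "k > 0" "d > 0" "X \<in> set_pmf (random_strings k d n)"
  shows "LCS {..<d} X \<le> n"
  using LCS_le_length[of 0 "{..<d}" X] random_strings_support[OF assms(1,3)] assms(2)
  by (auto simp: strings_def)

lemma expected_LCS_superadditive:
  assumes "k > 0" "d > 0"
  shows "expected_LCS k d m + expected_LCS k d n \<le> expected_LCS k d (m + n)"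
proof -
  let ?P = "pair_pmf (random_strings k d m) (random_strings k d n)"
  have fin: "finite (set_pmf ?P)"
    using finite_support_random_strings[OF assms(1)] by simp
  have int: "integrable ?P f" for f :: "_ \<Rightarrow> real"
    by (rule integrable_measure_pmf_finite[OF fin])
  have "expected_LCS k d m + expected_LCS k d n =
      measure_pmf.expectation (map_pmf fst ?P) (\<lambda>X. real (LCS {..<d} X)) +
      measure_pmf.expectation (map_pmf snd ?P) (\<lambda>X. real (LCS {..<d} X))"
    unfolding map_fst_pair_pmf map_snd_pair_pmf expected_LCS_def ..
  also have "\<dots> = measure_pmf.expectation ?P
      (\<lambda>Z. real (LCS {..<d} (fst Z)) + real (LCS {..<d} (snd Z)))"
    by (simp add: Bochner_Integration.integral_add[OF int int])
  also have "\<dots> \<le> measure_pmf.expectation ?P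
      (\<lambda>Z. real (LCS {..<d} (\<lambda>i. if i < d then fst Z i @ snd Z i else [])))"
  proof (intro integral_mono int)
    fix Z :: "(nat \<Rightarrow> nat list) \<times> (nat \<Rightarrow> nat list)"
    have "LCS {..<d} (\<lambda>i. if i < d then fst Z i @ snd Z i else []) = LCS {..<d} (\<lambda>i. fst Z i @ snd Z i)"
      by (rule LCS_cong) simp
    moreover have "{..<d} \<noteq> {}" using assms by auto
    ultimately show "real (LCS {..<d} (fst Z)) + real (LCS {..<d} (snd Z))
        \<le> real (LCS {..<d} (\<lambda>i. if i < d then fst Z i @ snd Z i else []))"
      using LCS_append[of "{..<d}" "fst Z" "snd Z"] by linarith
  qed
  also have "\<dots> = expected_LCS k d (m + n)"
    unfolding expected_LCS_def random_strings_add[OF assms(1)] by (simp add: case_prod_beta)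
  finally show ?thesis .
qed

text \<open>The \<open>lim\<close> in the definition carries information only once convergence is
  known, which Fekete's lemma supplies. All bounds on the constant below are comparisons of limits
  through this fact.\<close>

lemma expected_LCS_tendsto:
  assumes "k > 0" "d > 0"
  shows "(\<lambda>n. expected_LCS k d n / real n) \<longlonglongrightarrow> chvatal_sankoff k d"
proof -
  have int: "integrable (random_strings k d n) f" for f :: "_ \<Rightarrow> real" and n
    by (rule integrable_measure_pmf_finite[OF finite_support_random_strings[OF assms(1)]])
  have "expected_LCS k d n \<le> 1 * real n" for n
    unfolding expected_LCS_def using LCS_random_strings_le[OF assms]
    by (intro measure_pmf.integral_le_const int AE_pmfI) simp
  moreover have "0 \<le> expected_LCS k d n" for n
    unfolding expected_LCS_def by simp
  ultimately have "convergent (\<lambda>n. expected_LCS k d n / real n)"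
    using superadditive_ratio_convergent expected_LCS_superadditive[OF assms] by blast
  then show ?thesis
    unfolding chvatal_sankoff_def by (rule convergent_LIMSEQ_iff[THEN iffD1])
qed

subsection \<open>The upper bound\<close>

lemma prob_random_string_Suc:
  assumes "k > 0"
  shows "measure_pmf.prob (random_string k (Suc n)) S =
    (\<Sum>a\<in>{1..k}. measure_pmf.prob (random_string k n) {x. a # x \<in> S}) / real k"
proof -
  have fin: "finite (set_pmf (map_pmf (Cons a) (random_string k n)))" for a
    using assms by (simp add: set_random_string finite_strings)
  have "measure_pmf.prob (random_string k (Suc n)) S =
      measure_pmf.expectation (random_string k (Suc n)) (indicat_real S)"
    by simp
  also have "\<dots> = (\<Sum>a\<in>{1..k}. measure_pmf.prob (map_pmf (Cons a) (random_string k n)) S / real k)"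
    unfolding random_string_Suc[OF assms] using assms fin
    by (subst pmf_expectation_bind_pmf_of_set) (auto simp: divide_inverse mult.commute)
  finally show ?thesis
    by (simp add: vimage_def sum_divide_distrib)
qed

text \<open>Chernoff bound in multiplicative form: the right side is the generating function at
  \<open>t\<close> of a binomial \<open>(n, 1/k)\<close> variable. When \<open>w\<close> is matched
  greedily, the next letter of the string removes the head of \<open>w\<close> with probability
  \<open>1/k\<close> and otherwise leaves \<open>w\<close> unchanged, whatever that head is.\<close>

lemma prob_subseq_random_string:
  fixes t :: real
  assumes k: "k > 0" and t: "t \<ge> 1" and w: "set w \<subseteq> {1..k}"
  shows "measure_pmf.prob (random_string k n) {x. subseq w x} * t ^ length w \<le> (1 + (t - 1) / real k) ^ n"
  using w
proof (induction n arbitrary: w)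
  case 0
  then show ?case
    by (cases w) (simp_all add: random_string_0)
next
  case (Suc n)
  let ?c = "1 + (t - 1) / real k"
  show ?case
  proof (cases w)
    case Nil
    have "1 \<le> ?c ^ Suc n" using t k by (intro one_le_power) simp
    then show ?thesis using Nil by simp
  next
    case (Cons a v)
    let ?p = "\<lambda>w. measure_pmf.prob (random_string k n) {x. subseq w x}"
    have a: "a \<in> {1..k}" and v: "set v \<subseteq> {1..k}"
      using Suc.prems Cons by auto
    have "(\<Sum>b\<in>{1..k}. measure_pmf.prob (random_string k n) {x. subseq w (b # x)}) =
        measure_pmf.prob (random_string k n) {x. subseq w (a # x)} +
        (\<Sum>b\<in>{1..k} - {a}. measure_pmf.prob (random_string k n) {x. subseq w (b # x)})"
      using a by (intro sum.remove) auto
    also have "\<dots> = ?p v + (\<Sum>b\<in>{1..k} - {a}. ?p w)"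
      using Cons by (intro arg_cong2[where f = "(+)"] sum.cong) auto
    also have "(\<Sum>b\<in>{1..k} - {a}. ?p w) = (real k - 1) * ?p w"
      using a k by (simp add: of_nat_diff card_Diff_singleton)
    finally have sum: "(\<Sum>b\<in>{1..k}. measure_pmf.prob (random_string k n) {x. subseq w (b # x)}) =
        ?p v + (real k - 1) * ?p w" .
    have "measure_pmf.prob (random_string k (Suc n)) {x. subseq w x} =
        (?p v + (real k - 1) * ?p w) / real k"
      unfolding prob_random_string_Suc[OF k] mem_Collect_eq sum ..
    then have "measure_pmf.prob (random_string k (Suc n)) {x. subseq w x} * t ^ length w =
        (t * (?p v * t ^ length v) + (real k - 1) * (?p w * t ^ length w)) / real k"
      using Cons by (simp only: list.size power_Suc) (simp add: algebra_simps)
    also have "\<dots> \<le> (t * ?c ^ n + (real k - 1) * ?c ^ n) / real k"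
      using Suc.IH[OF v] Suc.IH[OF Suc.prems] t k
      by (intro divide_right_mono add_mono mult_left_mono) auto
    also have "\<dots> = ?c ^ Suc n"
      using k by (simp add: field_simps)
    finally show ?thesis .
  qed
qed

text \<open>Union bound over the \<open>k ^ m\<close> words; independence of the strings turns the
  bound for one string into its \<open>d\<close>-th power.\<close>

lemma prob_has_common_subseq_le:
  fixes t :: real
  assumes k: "k > 0" and d: "d > 0" and t: "t \<ge> 1"
  shows "measure_pmf.prob (random_strings k d n) {X. has_common_subseq m {..<d} X}
    \<le> real k ^ m * ((1 + (t - 1) / real k) ^ n / t ^ m) ^ d"
proof -
  let ?R = "random_strings k d n"
  let ?E = "\<lambda>w. Pi {..<d} (\<lambda>_. {x. subseq w x})"
  have "{X. has_common_subseq m {..<d} X} \<inter> set_pmf ?R \<subseteq> (\<Union>w\<in>strings k m. ?E w)"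
  proof
    fix X assume X: "X \<in> {X. has_common_subseq m {..<d} X} \<inter> set_pmf ?R"
    then obtain w where w: "length w = m" "\<forall>i<d. subseq w (X i)"
      by (auto simp: has_common_subseq_def)
    \<comment> \<open>The union ranges over words with letters in \<open>{1..k}\<close>. That
      \<open>w\<close> is such a word follows from its being a subsequence of \<open>X 0\<close>, an
      index available because \<open>d > 0\<close>.\<close>
    have "X 0 \<in> strings k n"
      using random_strings_support[OF k, of X d n] X d by auto
    moreover have "subseq w (X 0)"
      using w d by simp
    then have "set w \<subseteq> set (X 0)"
      by (auto elim: list_emb_set)
    ultimately have "w \<in> strings k m"
      using w by (auto simp: strings_def)
    with w show "X \<in> (\<Union>w\<in>strings k m. ?E w)"
      by auto
  qed
  then have "measure_pmf.prob ?R {X. has_common_subseq m {..<d} X}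
      \<le> measure_pmf.prob ?R (\<Union>w\<in>strings k m. ?E w)"
    by (subst measure_Int_set_pmf[symmetric]) (intro measure_pmf.finite_measure_mono, auto)
  also have "\<dots> \<le> (\<Sum>w\<in>strings k m. measure_pmf.prob ?R (?E w))"
    by (intro measure_UNION_le finite_strings) simp
  also have "\<dots> \<le> (\<Sum>w\<in>strings k m. ((1 + (t - 1) / real k) ^ n / t ^ m) ^ d)"
  proof (rule sum_mono)
    fix w assume w: "w \<in> strings k m"
    then have "measure_pmf.prob (random_string k n) {x. subseq w x} * t ^ m \<le> (1 + (t - 1) / real k) ^ n"
      using prob_subseq_random_string[OF k t, of w n] by (simp add: strings_def)
    then have "measure_pmf.prob (random_string k n) {x. subseq w x} \<le> (1 + (t - 1) / real k) ^ n / t ^ m"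
      using t by (subst pos_le_divide_eq) auto
    then show "measure_pmf.prob ?R (?E w) \<le> ((1 + (t - 1) / real k) ^ n / t ^ m) ^ d"
      unfolding random_strings_def by (subst measure_Pi_pmf_Pi) (auto intro: power_mono)
  qed
  finally show ?thesis by (simp add: card_strings)
qed

section \<open>From the exponential tail bound to the upper bound on the constant\<close>

lemma tendsto_nat_ceiling_ratio:
  fixes s :: real
  assumes "s \<ge> 0"
  shows "(\<lambda>n. real (nat \<lceil>s * real n\<rceil>) / real n) \<longlonglongrightarrow> s"
proof (rule tendsto_sandwich[where f = "\<lambda>_. s" and h = "\<lambda>n. s + 1 / real n"])
  show "(\<lambda>n. s + 1 / real n) \<longlonglongrightarrow> s"
    using tendsto_add[OF tendsto_const lim_const_over_n[of 1]] by simp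
  show "\<forall>\<^sub>F n in sequentially. s \<le> real (nat \<lceil>s * real n\<rceil>) / real n"
    using eventually_gt_at_top[of 0]
    by eventually_elim (simp add: le_divide_eq real_nat_ceiling_ge)
  show "\<forall>\<^sub>F n in sequentially. real (nat \<lceil>s * real n\<rceil>) / real n \<le> s + 1 / real n"
    using eventually_gt_at_top[of 0]
  proof eventually_elim
    case (elim n)
    have "real (nat \<lceil>s * real n\<rceil>) \<le> s * real n + 1"
      using assms of_int_ceiling_le_add_one[of "s * real n"] by simp
    then show ?case using elim by (simp add: field_simps)
  qed
qed simp

text \<open>For \<open>t = 1 + u\<close> and \<open>m\<close> close to \<open>s * n\<close>, the
  union bound is, up to a constant factor, the exponential of \<open>n\<close> times the left side
  of \<open>neg\<close>, so it vanishes. On the exceptional event the trivial bound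
  \<open>LCS \<le> n\<close> is enough.\<close>

lemma chvatal_sankoff_le:
  fixes s u :: real
  assumes k: "k > 0" and d: "d > 0" and s: "s \<ge> 0" and u: "u \<ge> 0"
    and neg: "s * ln (real k) + real d * (u / real k - s * ln (1 + u)) < 0"
  shows "chvatal_sankoff k d \<le> s"
proof -
  define \<kappa> where "\<kappa> = s * ln (real k) + real d * (u / real k - s * ln (1 + u))"
  define m where "m n = nat \<lceil>s * real n\<rceil>" for n
  have bound: "expected_LCS k d n / real n \<le> real (m n) / real n + real k * exp \<kappa> ^ n"
    if n: "n > 0" for n
  proof -
    let ?R = "random_strings k d n" and ?S = "{X. has_common_subseq (m n) {..<d} X}"
    have int: "integrable ?R f" for f :: "_ \<Rightarrow> real"
      by (rule integrable_measure_pmf_finite[OF finite_support_random_strings[OF k]])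
    have "expected_LCS k d n \<le> measure_pmf.expectation ?R (\<lambda>X. real (m n) + real n * indicator ?S X)"
      unfolding expected_LCS_def
    proof (rule integral_mono_AE[OF int int AE_pmfI])
      fix X assume "X \<in> set_pmf ?R"
      then have "LCS {..<d} X \<le> n" by (rule LCS_random_strings_le[OF k d])
      moreover have "LCS {..<d} X < m n" if "X \<notin> ?S"
        using that le_LCS_iff[of "{..<d}" "m n" X] d by force
      ultimately show "real (LCS {..<d} X) \<le> real (m n) + real n * indicator ?S X"
        by (auto simp: indicator_def)
    qed
    also have "\<dots> = real (m n) + real n * measure_pmf.prob ?R ?S"
      by (subst Bochner_Integration.integral_add[OF int int]) simp
    finally have "expected_LCS k d n / real n \<le> real (m n) / real n + measure_pmf.prob ?R ?S"
      using n by (simp add: field_simps)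
    also have "measure_pmf.prob ?R ?S \<le> real k ^ m n * ((1 + u / real k) ^ n / (1 + u) ^ m n) ^ d"
      using prob_has_common_subseq_le[OF k d, of "1 + u" n "m n"] u by simp
    also have "\<dots> \<le> real k ^ m n * (exp (u / real k) ^ n / (1 + u) ^ m n) ^ d"
      using u k by (intro mult_left_mono power_mono divide_right_mono) auto
    also have "\<dots> = exp (real (m n) * ln (real k) + real d * (real n * (u / real k) - real (m n) * ln (1 + u)))"
    proof -
      have "real k ^ m n = exp (real (m n) * ln (real k))"
        using k by (simp add: exp_of_nat_mult)
      moreover have "(1 + u) ^ m n = exp (real (m n) * ln (1 + u))"
        using u by (simp add: exp_of_nat_mult)
      moreover have "exp (u / real k) ^ n = exp (real n * (u / real k))"
        by (simp only: exp_of_nat_mult)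
      ultimately show ?thesis
        by (simp only: exp_add exp_diff exp_of_nat_mult)
    qed
    \<comment> \<open>Rounding \<open>s * n\<close> up to \<open>m n\<close> adds at most one letter
      to the words, hence one factor \<open>k\<close>; in the Chernoff term the rounding only
      helps.\<close>
    also have "\<dots> \<le> exp (ln (real k) + real n * \<kappa>)"
    proof -
      have "s * real n \<le> real (m n)" and "real (m n) \<le> s * real n + 1"
        unfolding m_def using s of_int_ceiling_le_add_one[of "s * real n"]
        by (simp_all add: real_nat_ceiling_ge)
      then have "real (m n) * ln (real k) \<le> (s * real n + 1) * ln (real k)"
          and "s * real n * ln (1 + u) \<le> real (m n) * ln (1 + u)"
        using k u by (auto intro!: mult_right_mono)
      then have "real (m n) * ln (real k) + real d * (real n * (u / real k) - real (m n) * ln (1 + u))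
          \<le> (s * real n + 1) * ln (real k) + real d * (real n * (u / real k) - s * real n * ln (1 + u))"
        by (intro add_mono mult_left_mono) auto
      then show ?thesis
        by (simp add: \<kappa>_def algebra_simps)
    qed
    also have "\<dots> = real k * exp \<kappa> ^ n"
      using k by (simp add: exp_add exp_of_nat_mult)
    finally show ?thesis by simp
  qed
  have "(\<lambda>n. real (m n) / real n + real k * exp \<kappa> ^ n) \<longlonglongrightarrow> s + real k * 0"
    unfolding m_def using neg
    by (intro tendsto_intros tendsto_nat_ceiling_ratio[OF s] LIMSEQ_realpow_zero) (auto simp: \<kappa>_def)
  then show ?thesis
    using bound by (intro LIMSEQ_le[OF expected_LCS_tendsto[OF k d]]) (auto intro!: exI[of _ 1])
qed

text \<open>\<open>\<epsilon>\<close> is the relative excess over \<open>1/k\<close>. With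
  \<open>u = \<epsilon> / 4\<close> and \<open>ln (1 + u) \<ge> u - u^2\<close>, each string gains
  at least \<open>\<epsilon>^2 / 8\<close> in the exponent (all exponents scaled by
  \<open>k\<close>). Since \<open>d * \<epsilon>^2 = 16 * log 2 k\<close>, the total gain is at
  least \<open>2 * log 2 k\<close>, which exceeds the cost
  \<open>(1 + \<epsilon>) * ln k \<le> 2 * ln k\<close> of the number of words.\<close>

lemma chvatal_sankoff_upper:
  assumes k: "k \<ge> 2" and d: "real d \<ge> 16 * log 2 (real k)"
  shows "chvatal_sankoff k d \<le> 1 / real k * (1 + 4 * sqrt (log 2 (real k) / real d))"
proof -
  define \<epsilon> where "\<epsilon> = 4 * sqrt (log 2 (real k) / real d)"
  define u where "u = \<epsilon> / 4"
  have lnk: "ln (real k) > 0" using k by simp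
  have log: "log 2 (real k) > ln (real k)"
    using lnk ln_2_less_1 by (simp add: log_def less_divide_eq)
  then have d0: "d > 0" using d lnk by (cases d) auto
  have sq: "real d * \<epsilon>\<^sup>2 = 16 * log 2 (real k)"
    using log lnk d0 by (simp add: \<epsilon>_def power_mult_distrib)
  \<comment> \<open>The constant 16 in the hypothesis is chosen to give
    \<open>\<epsilon> \<le> 1\<close>.\<close>
  have "log 2 (real k) / real d \<le> (1 / 4)\<^sup>2"
    using d d0 by (simp add: field_simps power2_eq_square)
  then have \<epsilon>: "0 \<le> \<epsilon>" "\<epsilon> \<le> 1"
    using log lnk real_le_lsqrt[of "1/4" "log 2 (real k) / real d"] by (auto simp: \<epsilon>_def)
  have "u - u\<^sup>2 \<le> ln (1 + u)"
    using \<epsilon> by (intro ln_one_plus_pos_lower_bound) (auto simp: u_def)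
  then have "(1 + \<epsilon>) * (u - u\<^sup>2) \<le> (1 + \<epsilon>) * ln (1 + u)"
    using \<epsilon> by (intro mult_left_mono) auto
  moreover have "\<epsilon>\<^sup>2 / 8 \<le> (1 + \<epsilon>) * (u - u\<^sup>2) - u"
  proof -
    have "\<epsilon> * \<epsilon>\<^sup>2 \<le> 1 * \<epsilon>\<^sup>2" using \<epsilon> by (intro mult_right_mono) auto
    moreover have "(1 + \<epsilon>) * (u - u\<^sup>2) - u = \<epsilon>\<^sup>2 / 4 - \<epsilon>\<^sup>2 / 16 - \<epsilon> * \<epsilon>\<^sup>2 / 16"
      by (simp add: u_def power2_eq_square field_simps)
    ultimately show ?thesis by simp
  qed
  ultimately have "real d * (u - (1 + \<epsilon>) * ln (1 + u)) \<le> real d * (- (\<epsilon>\<^sup>2 / 8))"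
    by (intro mult_left_mono) auto
  also have "\<dots> = - 2 * log 2 (real k)" using sq by simp
  also have "\<dots> < - 2 * ln (real k)" using log by simp
  finally have "real d * (u - (1 + \<epsilon>) * ln (1 + u)) < - 2 * ln (real k)" .
  moreover have "(1 + \<epsilon>) * ln (real k) \<le> 2 * ln (real k)"
    using \<epsilon> lnk by (intro mult_right_mono) auto
  ultimately have "(1 + \<epsilon>) * ln (real k) + real d * (u - (1 + \<epsilon>) * ln (1 + u)) < 0"
    by linarith
  then have "((1 + \<epsilon>) * ln (real k) + real d * (u - (1 + \<epsilon>) * ln (1 + u))) / real k < 0"
    using k by (intro divide_neg_pos) auto
  moreover have "((1 + \<epsilon>) * ln (real k) + real d * (u - (1 + \<epsilon>) * ln (1 + u))) / real k =
      (1 + \<epsilon>) / real k * ln (real k) + real d * (u / real k - (1 + \<epsilon>) / real k * ln (1 + u))"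
    using k by (simp add: field_simps)
  ultimately have "chvatal_sankoff k d \<le> (1 + \<epsilon>) / real k"
    using k d0 \<epsilon> by (intro chvatal_sankoff_le[where u = u]) (auto simp: u_def)
  then show ?thesis by (simp add: \<epsilon>_def)
qed

subsection \<open>Reading random strings letter by letter\<close>

primrec split_first :: "'a set \<Rightarrow> 'a list \<Rightarrow> ('a \<times> 'a list) option" where
  "split_first B [] = None"
| "split_first B (a # x) = (if a \<in> B then Some (a, x) else split_first B x)"

lemma split_first_SomeD:
  "split_first B x = Some (a, y) \<Longrightarrow> a \<in> B \<and> (\<exists>u. x = u @ a # y)"
proof (induction x)
  case (Cons b x)
  show ?case
  proof (cases "b \<in> B")
    case True
    then show ?thesis using Cons.prems by (auto intro: exI[of _ "[]"])
  next
    case False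
    then obtain u where "a \<in> B" "x = u @ a # y" using Cons by auto
    then show ?thesis by (auto intro: exI[of _ "b # u"])
  qed
qed simp

text \<open>Two-stage sampling: a coin decides whether the uniform letter falls into
  \<open>B\<close>, and given that it does, the letter is uniform on \<open>B\<close>. This
  separates the waiting time from the letter found.\<close>

lemma bind_pmf_of_set_if:
  assumes "finite A" "B \<subseteq> A" "B \<noteq> {}"
  shows "bind_pmf (pmf_of_set A) (\<lambda>a. if a \<in> B then f a else g) =
    bind_pmf (bernoulli_pmf (real (card B) / real (card A)))
      (\<lambda>c. if c then bind_pmf (pmf_of_set B) f else g)"
proof (rule pmf_eqI)
  fix x
  have fin: "finite B" "A \<noteq> {}" and card: "card B \<le> card A" "card B > 0" "card A > 0"
    using assms by (auto simp: card_mono card_gt_0_iff intro: finite_subset)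
  have "(\<Sum>a\<in>A. pmf (if a \<in> B then f a else g) x) =
      (\<Sum>a\<in>A - B. pmf (if a \<in> B then f a else g) x) + (\<Sum>a\<in>B. pmf (if a \<in> B then f a else g) x)"
    using assms by (intro sum.subset_diff) auto
  also have "(\<Sum>a\<in>A - B. pmf (if a \<in> B then f a else g) x) = (real (card A) - real (card B)) * pmf g x"
    using assms card fin by (simp add: card_Diff_subset of_nat_diff)
  finally have sum: "(\<Sum>a\<in>A. pmf (if a \<in> B then f a else g) x) =
      (real (card A) - real (card B)) * pmf g x + (\<Sum>a\<in>B. pmf (f a) x)"
    by simp
  let ?p = "real (card B) / real (card A)"
  have "pmf (bind_pmf (bernoulli_pmf ?p) (\<lambda>c. if c then bind_pmf (pmf_of_set B) f else g)) x =
      ?p * pmf (bind_pmf (pmf_of_set B) f) x + (1 - ?p) * pmf g x"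
    using card by (subst pmf_bind) simp
  also have "pmf (bind_pmf (pmf_of_set B) f) x = (\<Sum>a\<in>B. pmf (f a) x) / real (card B)"
    using assms fin by (intro pmf_bind_pmf_of_set)
  also have "?p * \<dots> + (1 - ?p) * pmf g x =
      (\<Sum>a\<in>A. pmf (if a \<in> B then f a else g) x) / real (card A)"
    unfolding sum using card by (simp add: field_simps)
  also have "\<dots> = pmf (bind_pmf (pmf_of_set A) (\<lambda>a. if a \<in> B then f a else g)) x"
    using assms fin by (intro pmf_bind_pmf_of_set[symmetric])
  finally show "pmf (bind_pmf (pmf_of_set A) (\<lambda>a. if a \<in> B then f a else g)) x =
      pmf (bind_pmf (bernoulli_pmf ?p) (\<lambda>c. if c then bind_pmf (pmf_of_set B) f else g)) x" ..
qed

text \<open>The search restarts afresh after each miss, so the waiting time \<open>b\<close> is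
  geometric and independent of the letter found, and what follows is again uniform. The geometric
  law is not truncated: \<open>b > n\<close> encodes that the string runs out. \<open>Suc\<close>
  counts the hit itself, since \<open>geometric_pmf\<close> counts failures.\<close>

lemma split_first_random_string:
  assumes k: "k > 0" and B: "B \<subseteq> {1..k}" "B \<noteq> {}"
  shows "map_pmf (split_first B) (random_string k n) =
    bind_pmf (pmf_of_set B) (\<lambda>a. bind_pmf (map_pmf Suc (geometric_pmf (real (card B) / real k)))
      (\<lambda>b. if b \<le> n then map_pmf (\<lambda>x. Some (a, x)) (random_string k (n - b)) else return_pmf None))"
proof (induction n)
  case 0
  show ?case
    by (simp add: random_string_0 bind_map_pmf)
next
  case (Suc n)
  define p where "p = real (card B) / real k"
  define F where "F n a = map_pmf (\<lambda>x. Some (a, x)) (random_string k n)" for n and a :: nat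
  define G where "G n a = bind_pmf (map_pmf Suc (geometric_pmf p))
      (\<lambda>b. if b \<le> n then F (n - b) a else return_pmf None)" for n and a :: nat
  have "card B \<le> card {1..k}" "finite B"
    using B by (auto intro: card_mono finite_subset simp del: card_atLeastAtMost)
  then have "card B \<le> k" "card B > 0"
    using B by (auto simp: card_gt_0_iff)
  then have p: "p \<in> {0<..1}" using k by (simp add: p_def)
  have IH: "map_pmf (split_first B) (random_string k n) = bind_pmf (pmf_of_set B) (G n)"
    unfolding G_def F_def p_def by (rule Suc.IH)
  \<comment> \<open>First trial of the geometric variable: success uses one letter and leaves
    \<open>n\<close>, failure repeats the search with budget \<open>n\<close>.\<close>
  have G_Suc: "G (Suc n) a = bind_pmf (bernoulli_pmf p) (\<lambda>c. if c then F n a else G n a)" for a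
    unfolding G_def
    by (subst geometric_bind_pmf_unfold[OF p])
       (auto simp: bind_map_pmf map_bind_pmf bind_assoc_pmf bind_return_pmf
             intro!: bind_pmf_cong split: if_splits)
  have "map_pmf (split_first B) (random_string k (Suc n)) =
      bind_pmf (pmf_of_set {1..k})
        (\<lambda>a. if a \<in> B then F n a else map_pmf (split_first B) (random_string k n))"
    unfolding random_string_Suc[OF k] map_bind_pmf
    by (intro bind_pmf_cong refl) (auto simp: pmf.map_comp o_def F_def)
  also have "\<dots> = bind_pmf (bernoulli_pmf p)
      (\<lambda>c. if c then bind_pmf (pmf_of_set B) (F n) else bind_pmf (pmf_of_set B) (G n))"
    unfolding IH using B by (subst bind_pmf_of_set_if) (simp_all add: p_def)
  also have "\<dots> = bind_pmf (bernoulli_pmf p)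
      (\<lambda>c. bind_pmf (pmf_of_set B) (\<lambda>a. if c then F n a else G n a))"
    by (intro bind_pmf_cong) auto
  also have "\<dots> = bind_pmf (pmf_of_set B) (G (Suc n))"
    unfolding G_Suc by (rule bind_commute_pmf)
  finally show ?case
    unfolding G_def[abs_def] F_def[abs_def] p_def .
qed

lemma nn_integral_geometric_pmf_power:
  fixes z :: real
  assumes p: "0 < p" "p \<le> 1" and z: "z \<ge> 0" "(1 - p) * z < 1"
  shows "(\<integral>\<^sup>+ b. ennreal (z ^ b) \<partial>map_pmf Suc (geometric_pmf p)) = ennreal (p * z / (1 - (1 - p) * z))"
proof -
  have "(\<integral>\<^sup>+ b. ennreal (z ^ b) \<partial>map_pmf Suc (geometric_pmf p)) =
      (\<Sum>b. ennreal (pmf (geometric_pmf p) b) * ennreal (z ^ Suc b))"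
    by (subst nn_integral_map_pmf) (simp add: nn_integral_measure_pmf nn_integral_count_space_nat)
  also have "\<dots> = (\<Sum>b. ennreal (p * z * ((1 - p) * z) ^ b))"
    using p z by (intro suminf_cong)
      (simp add: ennreal_mult[symmetric] power_mult_distrib mult_ac)
  also have "\<dots> = ennreal (p * z * (1 / (1 - (1 - p) * z)))"
    using p z by (intro suminf_ennreal_eq sums_mult geometric_sums mult_nonneg_nonneg) auto
  finally show ?thesis by simp
qed

text \<open>The lengths depend on the index because after a few greedy rounds the strings have used
  up different numbers of letters.\<close>

abbreviation string_tuple :: "nat \<Rightarrow> nat \<Rightarrow> (nat \<Rightarrow> nat) \<Rightarrow> (nat \<Rightarrow> nat list) pmf" where
  "string_tuple k d \<nu> \<equiv> Pi_pmf {..<d} [] (\<lambda>i. random_string k (\<nu> i))"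

lemma Pi_pmf_map_dependent:
  assumes "finite A"
  shows "Pi_pmf A dflt' (\<lambda>i. map_pmf (f i) (p i)) =
    map_pmf (\<lambda>X i. if i \<in> A then f i (X i) else dflt') (Pi_pmf A dflt p)"
  unfolding map_pmf_def using assms by (subst Pi_pmf_bind[where d' = dflt]) auto

text \<open>One round of a greedy strategy as seen by a potential argument: string \<open>i\<close> loses a prefix of
  random length with law \<open>L i\<close> and reports a letter \<open>\<tau> i\<close>, after which the rest is again uniform.
  Running out of letters (\<open>None\<close>) needs no separate treatment, because then the claimed bound exceeds 1.\<close>

lemma emeasure_string_tuple_advance:
  fixes f :: "nat \<Rightarrow> nat list \<Rightarrow> ('t \<times> nat list) option" and z :: real
  assumes law: "\<And>i n. map_pmf (f i) (random_string k n) =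
      bind_pmf (U i) (\<lambda>t. bind_pmf (L i)
        (\<lambda>b. if b \<le> n then map_pmf (\<lambda>x. Some (t, x)) (random_string k (n - b)) else return_pmf None))"
    and step: "\<And>X \<tau> Y. X \<in> S \<Longrightarrow> \<forall>i<d. f i (X i) = Some (\<tau> i, Y i) \<Longrightarrow> Y \<in> S' \<tau>"
    and bound: "\<And>\<tau> \<nu>. emeasure (string_tuple k d \<nu>) (S' \<tau>) \<le> (\<Sum>i<d. c \<tau> i * ennreal ((1 / z) ^ \<nu> i))"
    and c: "\<And>\<tau> i. c \<tau> i \<ge> 1" and z: "z \<ge> 1"
  shows "emeasure (string_tuple k d \<nu>) S \<le>
    (\<integral>\<^sup>+ \<tau>. (\<Sum>i<d. c \<tau> i * ennreal ((1 / z) ^ \<nu> i) * (\<integral>\<^sup>+ b. ennreal (z ^ b) \<partial>L i)) \<partial>Pi_pmf {..<d} dt U)"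
proof -
  \<comment> \<open>\<open>T\<close> is an event about the reports \<open>W X\<close>. Fixing the
    values outside \<open>{..<d}\<close> makes \<open>\<tau>\<close> and \<open>Y\<close>
    recoverable from the reports.\<close>
  define T where "T = {W. (\<exists>i<d. W i = None) \<or>
    (\<exists>\<tau> Y. (\<forall>i<d. W i = Some (\<tau> i, Y i)) \<and> (\<forall>i. i \<notin> {..<d} \<longrightarrow> \<tau> i = dt \<and> Y i = []) \<and> Y \<in> S' \<tau>)}"
  define W where "W X i = (if i \<in> {..<d} then f i (X i) else None)" for X and i
  \<comment> \<open>The conditional law of the reports once all letters \<open>\<tau>\<close> and
    all prefix lengths \<open>\<beta>\<close> have been drawn.\<close>
  define Q where "Q \<tau> \<beta> = Pi_pmf {..<d} None (\<lambda>i. if \<beta> i \<le> \<nu> i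
      then map_pmf (\<lambda>x. Some (\<tau> i, x)) (random_string k (\<nu> i - \<beta> i)) else return_pmf None)"
    for \<tau> :: "nat \<Rightarrow> 't" and \<beta> :: "nat \<Rightarrow> nat"
  have "W X \<in> T" if "X \<in> S" for X
  proof (cases "\<exists>i<d. f i (X i) = None")
    case True
    then show ?thesis by (auto simp: T_def W_def)
  next
    case False
    define \<tau> where "\<tau> i = (if i < d then fst (the (f i (X i))) else dt)" for i
    define Y where "Y i = (if i < d then snd (the (f i (X i))) else [])" for i
    have *: "\<forall>i<d. f i (X i) = Some (\<tau> i, Y i)"
      using False by (auto simp: \<tau>_def Y_def)
    then have "Y \<in> S' \<tau>" using step that by blast
    with * have "\<forall>i<d. W X i = Some (\<tau> i, Y i)" "\<forall>i. i \<notin> {..<d} \<longrightarrow> \<tau> i = dt \<and> Y i = []" "Y \<in> S' \<tau>"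
      by (auto simp: W_def \<tau>_def Y_def)
    then show ?thesis unfolding T_def by blast
  qed
  then have "emeasure (string_tuple k d \<nu>) S \<le> emeasure (string_tuple k d \<nu>) (W -` T)"
    by (intro emeasure_mono) auto
  also have "\<dots> = emeasure (map_pmf W (string_tuple k d \<nu>)) T"
    by simp
  also have "map_pmf W (string_tuple k d \<nu>) = Pi_pmf {..<d} None (\<lambda>i. map_pmf (f i) (random_string k (\<nu> i)))"
    unfolding W_def by (subst Pi_pmf_map_dependent[where dflt = "[]"]) simp_all
  also have "\<dots> = bind_pmf (Pi_pmf {..<d} dt U) (\<lambda>\<tau>. bind_pmf (Pi_pmf {..<d} 0 L) (Q \<tau>))"
    unfolding law Q_def
    by (subst Pi_pmf_bind[where d' = dt], simp, subst Pi_pmf_bind[where d' = 0], simp) simp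
  also have "emeasure \<dots> T = (\<integral>\<^sup>+ \<tau>. \<integral>\<^sup>+ \<beta>. emeasure (Q \<tau> \<beta>) T \<partial>Pi_pmf {..<d} 0 L \<partial>Pi_pmf {..<d} dt U)"
    by (simp add: emeasure_bind_pmf)
  also have "\<dots> \<le> (\<integral>\<^sup>+ \<tau>. \<integral>\<^sup>+ \<beta>. (\<Sum>i<d. c \<tau> i * ennreal ((1 / z) ^ \<nu> i) * ennreal (z ^ \<beta> i))
      \<partial>Pi_pmf {..<d} 0 L \<partial>Pi_pmf {..<d} dt U)"
  proof (intro nn_integral_mono_AE AE_pmfI)
    fix \<tau> \<beta> assume "\<tau> \<in> set_pmf (Pi_pmf {..<d} dt U)"
    then have \<tau>: "\<forall>i. i \<notin> {..<d} \<longrightarrow> \<tau> i = dt"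
      using set_Pi_pmf_subset[of "{..<d}" dt U] by auto
    show "emeasure (Q \<tau> \<beta>) T \<le> (\<Sum>i<d. c \<tau> i * ennreal ((1 / z) ^ \<nu> i) * ennreal (z ^ \<beta> i))"
    proof (cases "\<forall>i<d. \<beta> i \<le> \<nu> i")
      case True
      define V where "V Y i = (if i \<in> {..<d} then Some (\<tau> i, Y i) else None)" for Y :: "nat \<Rightarrow> nat list" and i
      have "Q \<tau> \<beta> = Pi_pmf {..<d} None (\<lambda>i. map_pmf (\<lambda>x. Some (\<tau> i, x)) (random_string k (\<nu> i - \<beta> i)))"
        unfolding Q_def using True by (intro Pi_pmf_cong) auto
      also have "\<dots> = map_pmf V (string_tuple k d (\<lambda>i. \<nu> i - \<beta> i))"
        unfolding V_def by (subst Pi_pmf_map_dependent[where dflt = "[]"]) simp_all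
      finally have "emeasure (Q \<tau> \<beta>) T = emeasure (string_tuple k d (\<lambda>i. \<nu> i - \<beta> i)) (V -` T)"
        by simp
      also have "\<dots> \<le> emeasure (string_tuple k d (\<lambda>i. \<nu> i - \<beta> i)) (S' \<tau>)"
      proof (intro emeasure_mono_AE AE_pmfI impI)
        fix Y assume Y: "Y \<in> set_pmf (string_tuple k d (\<lambda>i. \<nu> i - \<beta> i))" "Y \<in> V -` T"
        then have Y0: "\<forall>i. i \<notin> {..<d} \<longrightarrow> Y i = []"
          using set_Pi_pmf_subset[of "{..<d}" "[]" "\<lambda>i. random_string k (\<nu> i - \<beta> i)"] by auto
        from Y(2) obtain \<tau>' Y' where *: "\<forall>i<d. V Y i = Some (\<tau>' i, Y' i)"
            "\<forall>i. i \<notin> {..<d} \<longrightarrow> \<tau>' i = dt \<and> Y' i = []" "Y' \<in> S' \<tau>'"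
          by (auto simp: T_def V_def)
        have "\<tau>' = \<tau>" "Y' = Y"
          using * \<tau> Y0 by (auto simp: fun_eq_iff V_def) (metis lessThan_iff)+
        with * show "Y \<in> S' \<tau>" by simp
      qed simp
      also have "\<dots> \<le> (\<Sum>i<d. c \<tau> i * ennreal ((1 / z) ^ (\<nu> i - \<beta> i)))"
        by (rule bound)
      also have "\<dots> = (\<Sum>i<d. c \<tau> i * ennreal ((1 / z) ^ \<nu> i) * ennreal (z ^ \<beta> i))"
      proof (intro sum.cong refl)
        fix i assume "i \<in> {..<d}"
        then have "(1 / z) ^ (\<nu> i - \<beta> i) = (1 / z) ^ \<nu> i * z ^ \<beta> i"
          using True z by (simp add: power_diff power_one_over field_simps)
        then show "c \<tau> i * ennreal ((1 / z) ^ (\<nu> i - \<beta> i)) = c \<tau> i * ennreal ((1 / z) ^ \<nu> i) * ennreal (z ^ \<beta> i)"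
          using z by (simp add: ennreal_mult mult.assoc)
      qed
      finally show ?thesis .
    next
      case False
      then obtain i where i: "i < d" "\<nu> i < \<beta> i" by force
      have "emeasure (Q \<tau> \<beta>) T \<le> 1"
        by (simp add: measure_pmf.emeasure_eq_measure)
      also have "1 * 1 \<le> c \<tau> i * ennreal ((1 / z) ^ \<nu> i * z ^ \<beta> i)"
      proof (intro mult_mono c)
        have "z ^ \<nu> i \<le> z ^ \<beta> i" using i z by (intro power_increasing) auto
        then have "1 \<le> (1 / z) ^ \<nu> i * z ^ \<beta> i"
          using z by (simp add: power_one_over field_simps)
        then show "1 \<le> ennreal ((1 / z) ^ \<nu> i * z ^ \<beta> i)" by simp
      qed auto
      then have "1 \<le> c \<tau> i * ennreal ((1 / z) ^ \<nu> i) * ennreal (z ^ \<beta> i)"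
        using z by (simp add: ennreal_mult mult.assoc)
      also have "\<dots> \<le> (\<Sum>i<d. c \<tau> i * ennreal ((1 / z) ^ \<nu> i) * ennreal (z ^ \<beta> i))"
        using i by (intro member_le_sum) auto
      finally show ?thesis .
    qed
  qed
  also have "\<dots> = (\<integral>\<^sup>+ \<tau>. (\<Sum>i<d. c \<tau> i * ennreal ((1 / z) ^ \<nu> i) *
      (\<integral>\<^sup>+ \<beta>. ennreal (z ^ \<beta> i) \<partial>Pi_pmf {..<d} 0 L)) \<partial>Pi_pmf {..<d} dt U)"
    by (simp add: nn_integral_sum nn_integral_cmult)
  \<comment> \<open>Each summand depends on a single coordinate of \<open>\<beta>\<close>, so the
    product law may be replaced by its marginal \<open>L i\<close>.\<close>
  also have "\<dots> = (\<integral>\<^sup>+ \<tau>. (\<Sum>i<d. c \<tau> i * ennreal ((1 / z) ^ \<nu> i) * (\<integral>\<^sup>+ b. ennreal (z ^ b) \<partial>L i)) \<partial>Pi_pmf {..<d} dt U)"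
  proof -
    have "(\<integral>\<^sup>+ \<beta>. ennreal (z ^ \<beta> i) \<partial>Pi_pmf {..<d} 0 L) = (\<integral>\<^sup>+ b. ennreal (z ^ b) \<partial>L i)" if "i < d" for i
    proof -
      have "(\<integral>\<^sup>+ \<beta>. ennreal (z ^ \<beta> i) \<partial>Pi_pmf {..<d} 0 L) =
          (\<integral>\<^sup>+ b. ennreal (z ^ b) \<partial>map_pmf (\<lambda>\<beta>. \<beta> i) (Pi_pmf {..<d} 0 L))"
        by simp
      also have "map_pmf (\<lambda>\<beta>. \<beta> i) (Pi_pmf {..<d} 0 L) = L i"
        using that by (simp add: Pi_pmf_component)
      finally show ?thesis .
    qed
    then show ?thesis by (intro nn_integral_cong sum.cong) auto
  qed
  finally show ?thesis .
qed

subsection \<open>Majority votes\<close>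

text \<open>The letters 1 and 2 count as the signs \<open>1\<close> and \<open>-1\<close>.\<close>

definition vote_sum :: "nat \<Rightarrow> (nat \<Rightarrow> nat) \<Rightarrow> real" where
  "vote_sum d \<tau> = (\<Sum>i<d. 3 - 2 * real (\<tau> i))"

definition majority :: "nat \<Rightarrow> (nat \<Rightarrow> nat) \<Rightarrow> nat" where
  "majority d \<tau> = (if vote_sum d \<tau> \<ge> 0 then 1 else 2)"

definition ballots :: "nat \<Rightarrow> (nat \<Rightarrow> nat) pmf" where
  "ballots d = Pi_pmf {..<d} 1 (\<lambda>_. pmf_of_set {1, 2})"

text \<open>Index 0 stands for any voter: the votes are exchangeable.\<close>

definition disagreement :: "nat \<Rightarrow> real" where
  "disagreement d = measure_pmf.prob (ballots d) {\<tau>. \<tau> 0 \<noteq> majority d \<tau>}"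

lemma ballots_support: "\<tau> \<in> set_pmf (ballots d) \<Longrightarrow> i < d \<Longrightarrow> \<tau> i = 1 \<or> \<tau> i = 2"
  by (auto simp: ballots_def set_Pi_pmf PiE_dflt_def)

lemma finite_support_ballots: "finite (set_pmf (ballots d))"
  by (auto simp: ballots_def set_Pi_pmf intro!: finite_PiE_dflt)

lemma integrable_ballots: "integrable (ballots d) (f :: _ \<Rightarrow> real)"
  by (rule integrable_measure_pmf_finite[OF finite_support_ballots])

lemmas expectation_ballots_add = Bochner_Integration.integral_add[OF integrable_ballots integrable_ballots]
lemmas expectation_ballots_diff = Bochner_Integration.integral_diff[OF integrable_ballots integrable_ballots]

text \<open>Swapping the voters 0 and \<open>i\<close> preserves both the law of the ballots and the
  vote sum.\<close>

lemma prob_disagreement: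
  assumes "i < d"
  shows "measure_pmf.prob (ballots d) {\<tau>. \<tau> i \<noteq> majority d \<tau>} = disagreement d"
proof -
  let ?h = "Transposition.transpose 0 i"
  have h: "bij_betw ?h {..<d} {..<d}"
    using assms by (intro bij_betw_byWitness[where f' = ?h]) (auto simp: Transposition.transpose_def)
  have eq: "ballots d = map_pmf (\<lambda>g. g \<circ> ?h) (ballots d)"
    unfolding ballots_def using h assms by (intro Pi_pmf_bij_betw) (auto simp: Transposition.transpose_def)
  have "measure_pmf.prob (ballots d) {\<tau>. \<tau> i \<noteq> majority d \<tau>} =
      measure_pmf.prob (ballots d) ((\<lambda>g. g \<circ> ?h) -` {\<tau>. \<tau> i \<noteq> majority d \<tau>})"
    by (subst eq) simp
  moreover have "majority d (g \<circ> ?h) = majority d g" for g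
    using sum.reindex_bij_betw[OF h, of "\<lambda>j. 3 - 2 * real (g j)"]
    by (simp add: majority_def vote_sum_def)
  ultimately show ?thesis
    by (simp add: disagreement_def vimage_def)
qed

text \<open>The last vote is an independent fair sign. Taking powers for \<open>F\<close> gives
  recursions for the moments.\<close>

lemma expectation_vote_sum_Suc:
  fixes F :: "real \<Rightarrow> real"
  shows "measure_pmf.expectation (ballots (Suc d)) (\<lambda>\<tau>. F (vote_sum (Suc d) \<tau>)) =
    measure_pmf.expectation (ballots d) (\<lambda>\<tau>. (F (vote_sum d \<tau> + 1) + F (vote_sum d \<tau> - 1)) / 2)"
proof -
  have vs: "vote_sum (Suc d) (\<tau>(d := y)) = vote_sum d \<tau> + (3 - 2 * real y)" for \<tau> y
    by (simp add: vote_sum_def)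
  have "ballots (Suc d) = bind_pmf (pmf_of_set {1, 2}) (\<lambda>y. map_pmf (\<lambda>\<tau>. \<tau>(d := y)) (ballots d))"
    unfolding ballots_def lessThan_Suc by (subst Pi_pmf_insert') (auto simp: map_pmf_def)
  then have "measure_pmf.expectation (ballots (Suc d)) (\<lambda>\<tau>. F (vote_sum (Suc d) \<tau>)) =
     (\<Sum>y\<in>{1, 2::nat}. measure_pmf.expectation (map_pmf (\<lambda>\<tau>. \<tau>(d := y)) (ballots d))
       (\<lambda>\<tau>. F (vote_sum (Suc d) \<tau>)) /\<^sub>R real (card {1, 2::nat}))"
    by (simp only:) (subst pmf_expectation_bind_pmf_of_set, auto simp: finite_support_ballots)
  also have "\<dots> = measure_pmf.expectation (ballots d) (\<lambda>\<tau>. (F (vote_sum d \<tau> + 1) + F (vote_sum d \<tau> - 1)) / 2)"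
    by (simp add: vs expectation_ballots_add add_divide_distrib)
  finally show ?thesis .
qed

lemma expectation_vote_sum_power2:
  "measure_pmf.expectation (ballots d) (\<lambda>\<tau>. (vote_sum d \<tau>)\<^sup>2) = real d"
proof (induction d)
  case (Suc d)
  have "((s + 1)\<^sup>2 + (s - 1)\<^sup>2) / 2 = s\<^sup>2 + 1" for s :: real
    by (simp add: power2_eq_square field_simps)
  then show ?case
    using Suc by (simp add: expectation_vote_sum_Suc[where F = "\<lambda>s. s\<^sup>2"] expectation_ballots_add)
qed (simp add: vote_sum_def)

lemma expectation_vote_sum_power4:
  "measure_pmf.expectation (ballots d) (\<lambda>\<tau>. vote_sum d \<tau> ^ 4) = 3 * (real d)\<^sup>2 - 2 * real d"
proof (induction d)
  case (Suc d)
  have "((s + 1) ^ 4 + (s - 1) ^ 4) / 2 = s ^ 4 + (6 * s\<^sup>2 + 1)" for s :: real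
    by (simp add: power2_eq_square power4_eq_xxxx field_simps)
  then have "measure_pmf.expectation (ballots (Suc d)) (\<lambda>\<tau>. vote_sum (Suc d) \<tau> ^ 4) =
      3 * (real d)\<^sup>2 - 2 * real d + (6 * real d + 1)"
    using Suc by (simp add: expectation_vote_sum_Suc[where F = "\<lambda>s. s ^ 4"] expectation_vote_sum_power2
        expectation_ballots_add)
  then show ?case
    by (simp add: power2_eq_square field_simps)
qed (simp add: vote_sum_def)

text \<open>Turns the second and fourth moments of the vote sum into a lower bound for its mean absolute
  value. With quadratic coefficient 1, the constant \<open>4/27\<close> is the best possible, with equality at \<open>3/2\<close>.\<close>

lemma abs_ge_quartic: "x\<^sup>2 - 4 / 27 * x ^ 4 \<le> \<bar>x\<bar>" for x :: real
proof -
  define y where "y = \<bar>x\<bar>"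
  have y: "y \<ge> 0" by (simp add: y_def)
  have "y - (y\<^sup>2 - 4 / 27 * y ^ 4) = 4 / 27 * y * ((y - 3 / 2)\<^sup>2 * (y + 3))"
    by (simp add: power2_eq_square power4_eq_xxxx field_simps)
  also have "\<dots> \<ge> 0" using y by simp
  finally have "y\<^sup>2 - 4 / 27 * y ^ 4 \<le> y" by simp
  then show ?thesis by (simp add: y_def power_even_abs)
qed

text \<open>Apply \<open>abs_ge_quartic\<close> to the vote sum divided by \<open>sqrt d\<close>.
  The second moment \<open>d\<close> and a fourth moment of at most \<open>3 * d^2\<close> leave the
  constant \<open>1 - 3 * 4/27 = 5/9\<close>.\<close>

lemma expectation_abs_vote_sum_ge:
  assumes "d > 0"
  shows "5 / 9 * sqrt (real d) \<le> measure_pmf.expectation (ballots d) (\<lambda>\<tau>. \<bar>vote_sum d \<tau>\<bar>)"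
proof -
  define r where "r = sqrt (real d)"
  have r: "r > 0" "r\<^sup>2 = real d" using assms by (auto simp: r_def)
  have "5 / 9 * r = r\<^sup>2 / r - 4 / 27 * (3 * (r\<^sup>2)\<^sup>2) / r ^ 3"
    using r(1) by (simp add: field_simps eval_nat_numeral)
  also have "\<dots> \<le> r\<^sup>2 / r - 4 / 27 * (3 * (r\<^sup>2)\<^sup>2 - 2 * r\<^sup>2) / r ^ 3"
    using r(1) by (intro diff_mono divide_right_mono mult_left_mono) auto
  also have "\<dots> = measure_pmf.expectation (ballots d)
      (\<lambda>\<tau>. (vote_sum d \<tau>)\<^sup>2 / r - 4 / 27 * vote_sum d \<tau> ^ 4 / r ^ 3)"
    unfolding r(2)
    by (subst expectation_ballots_diff)
       (simp add: expectation_vote_sum_power2 expectation_vote_sum_power4)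
  also have "\<dots> \<le> measure_pmf.expectation (ballots d) (\<lambda>\<tau>. \<bar>vote_sum d \<tau>\<bar>)"
  proof (intro integral_mono integrable_ballots)
    fix \<tau> :: "nat \<Rightarrow> nat"
    let ?s = "vote_sum d \<tau>"
    have "r * ((?s / r)\<^sup>2 - 4 / 27 * (?s / r) ^ 4) \<le> r * \<bar>?s / r\<bar>"
      using r by (intro mult_left_mono abs_ge_quartic) auto
    moreover have "r * ((?s / r)\<^sup>2 - 4 / 27 * (?s / r) ^ 4) = ?s\<^sup>2 / r - 4 / 27 * ?s ^ 4 / r ^ 3"
      using r(1) by (simp add: field_simps eval_nat_numeral)
    moreover have "r * \<bar>?s / r\<bar> = \<bar>?s\<bar>" using r by simp
    ultimately show "?s\<^sup>2 / r - 4 / 27 * ?s ^ 4 / r ^ 3 \<le> \<bar>?s\<bar>" by simp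
  qed
  finally show ?thesis by (simp add: r_def)
qed

text \<open>Multiplied by the majority sign, a vote contributes 1 if it agrees and -1 if it does
  not. So the absolute vote sum is agreements minus disagreements, with mean
  \<open>d * (1 - 2 * disagreement d)\<close>.\<close>

lemma disagreement_le:
  assumes d: "d > 0"
  shows "disagreement d \<le> 1 / 2 - 5 / 18 / sqrt (real d)"
proof -
  let ?D = "\<lambda>i. {\<tau>. \<tau> i \<noteq> majority d \<tau>}"
  have "measure_pmf.expectation (ballots d) (\<lambda>\<tau>. \<bar>vote_sum d \<tau>\<bar>) =
      measure_pmf.expectation (ballots d) (\<lambda>\<tau>. \<Sum>i<d. 1 - 2 * indicat_real (?D i) \<tau>)"
  proof (intro integral_cong_AE AE_pmfI)
    fix \<tau> assume \<tau>: "\<tau> \<in> set_pmf (ballots d)"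
    have "\<bar>vote_sum d \<tau>\<bar> = (if vote_sum d \<tau> \<ge> 0 then 1 else -1) * vote_sum d \<tau>" by simp
    also have "\<dots> = (\<Sum>i<d. (if vote_sum d \<tau> \<ge> 0 then 1 else -1) * (3 - 2 * real (\<tau> i)))"
      by (subst (2) vote_sum_def) (simp only: sum_distrib_left)
    also have "\<dots> = (\<Sum>i<d. 1 - 2 * indicat_real (?D i) \<tau>)"
      using ballots_support[OF \<tau>] by (intro sum.cong refl) (force simp: majority_def indicator_def)
    finally show "\<bar>vote_sum d \<tau>\<bar> = (\<Sum>i<d. 1 - 2 * indicat_real (?D i) \<tau>)" .
  qed simp_all
  also have "\<dots> = (\<Sum>i<d. 1 - 2 * disagreement d)"
    using prob_disagreement
    by (subst Bochner_Integration.integral_sum[OF integrable_ballots])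
       (simp add: expectation_ballots_diff)
  finally have "5 / 9 * sqrt (real d) \<le> real d * (1 - 2 * disagreement d)"
    using expectation_abs_vote_sum_ge[OF d] by simp
  also have "\<dots> = sqrt (real d) * (sqrt (real d) * (1 - 2 * disagreement d))"
    by (simp add: mult.assoc[symmetric])
  finally have "sqrt (real d) * (5 / 9) \<le> sqrt (real d) * (sqrt (real d) * (1 - 2 * disagreement d))"
    by (simp only: mult.commute)
  then have "5 / 9 \<le> sqrt (real d) * (1 - 2 * disagreement d)"
    using d by (simp only: mult_le_cancel_left_pos real_sqrt_gt_0_iff of_nat_0_less_iff)
  then have "5 / 9 / sqrt (real d) \<le> 1 - 2 * disagreement d"
    using d by (simp add: pos_divide_le_eq mult_ac)
  then show ?thesis by simp
qed

subsection \<open>The lower bound\<close>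

text \<open>The probability generating function of the waiting time for a first success of
  probability \<open>p\<close>, valid while \<open>(1 - p) * z < 1\<close>.\<close>

definition geometric_mgf :: "real \<Rightarrow> real \<Rightarrow> real" where
  "geometric_mgf p z = p * z / (1 - (1 - p) * z)"

lemma geometric_mgf_ge_1:
  assumes "(1 - p) * z < 1" "z \<ge> 1"
  shows "geometric_mgf p z \<ge> 1"
  unfolding geometric_mgf_def using assms by (subst le_divide_eq_1_pos) (auto simp: algebra_simps)

lemma geometric_mgf_deriv:
  assumes "p > 0"
  shows "(geometric_mgf p has_real_derivative 1 / p) (at 1)"
  unfolding geometric_mgf_def using assms
  by (auto intro!: derivative_eq_intros simp: field_simps power2_eq_square)

text \<open>Second half of a greedy round, after the votes \<open>h\<close> have been read. A string
  with head \<open>M\<close> pays nothing more; every other string searches for \<open>M\<close> in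
  its rest, a geometric waiting time with success probability \<open>1/k\<close>.\<close>

lemma emeasure_no_common_subseq_after_heads:
  fixes z :: real
  assumes k: "k > 0" and M: "M \<in> {1..k}" and z: "z \<ge> 1" "(1 - 1 / real k) * z < 1"
    and C: "C \<ge> 1"
    and bound: "\<And>\<nu>. emeasure (string_tuple k d \<nu>) {X. \<not> has_common_subseq m {..<d} X}
        \<le> (\<Sum>i<d. C * ennreal ((1 / z) ^ \<nu> i))"
  shows "emeasure (string_tuple k d \<nu>) {X. \<not> has_common_subseq (Suc m) {..<d} (\<lambda>i. h i # X i)}
    \<le> (\<Sum>i<d. C * ennreal (if h i = M then 1 else geometric_mgf (1 / real k) z) * ennreal ((1 / z) ^ \<nu> i))"
proof -
  define f where "f i x = (if h i = M then Some ((), x)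
      else map_option (\<lambda>(a, y). ((), y)) (split_first {M} x))" for i and x
  \<comment> \<open>Length 0 in case of agreement: the head is not counted in \<open>\<nu>\<close>,
    as the first half of the round has already charged it.\<close>
  define L where "L i = (if h i = M then return_pmf 0 else map_pmf Suc (geometric_pmf (1 / real k)))" for i
  have "emeasure (string_tuple k d \<nu>) {X. \<not> has_common_subseq (Suc m) {..<d} (\<lambda>i. h i # X i)} \<le>
    (\<integral>\<^sup>+ \<tau>. (\<Sum>i<d. C * ennreal ((1 / z) ^ \<nu> i) * (\<integral>\<^sup>+ b. ennreal (z ^ b) \<partial>L i))
      \<partial>Pi_pmf {..<d} () (\<lambda>_. return_pmf ()))"
  proof (rule emeasure_string_tuple_advance[where f = f and S' = "\<lambda>_. {X. \<not> has_common_subseq m {..<d} X}"])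
    fix i n
    show "map_pmf (f i) (random_string k n) = bind_pmf (return_pmf ()) (\<lambda>t. bind_pmf (L i)
        (\<lambda>b. if b \<le> n then map_pmf (\<lambda>x. Some (t, x)) (random_string k (n - b)) else return_pmf None))"
    proof (cases "h i = M")
      case True
      then show ?thesis by (simp add: f_def[abs_def] L_def bind_return_pmf)
    next
      case False
      have "map_pmf (f i) (random_string k n) =
          map_pmf (map_option (\<lambda>(a, y). ((), y))) (map_pmf (split_first {M}) (random_string k n))"
        using False by (simp add: f_def[abs_def] pmf.map_comp o_def)
      also have "map_pmf (split_first {M}) (random_string k n) =
          bind_pmf (map_pmf Suc (geometric_pmf (1 / real k)))
            (\<lambda>b. if b \<le> n then map_pmf (\<lambda>x. Some (M, x)) (random_string k (n - b)) else return_pmf None)"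
        using M by (subst split_first_random_string[OF k]) (simp_all add: pmf_of_set_singleton bind_return_pmf)
      finally show ?thesis
        using False unfolding L_def
        by (auto simp: map_bind_pmf bind_return_pmf pmf.map_comp o_def intro!: bind_pmf_cong)
    qed
  next
    fix X \<tau> Y
    assume X: "X \<in> {X. \<not> has_common_subseq (Suc m) {..<d} (\<lambda>i. h i # X i)}"
      and fX: "\<forall>i<d. f i (X i) = Some (\<tau> i, Y i)"
    have "\<exists>u. h i # X i = u @ M # Y i" if "i \<in> {..<d}" for i
    proof (cases "h i = M")
      case True
      then have "h i # X i = [] @ M # Y i" using fX that by (auto simp: f_def)
      then show ?thesis by blast
    next
      case False
      then have "map_option (\<lambda>(a, y). ((), y)) (split_first {M} (X i)) = Some ((), Y i)"
        using fX[rule_format, of i] that by (simp add: f_def)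
      then obtain a where a: "split_first {M} (X i) = Some (a, Y i)"
        by auto
      obtain u where "X i = u @ M # Y i"
        using split_first_SomeD[OF a] by auto
      then have "h i # X i = (h i # u) @ M # Y i" by simp
      then show ?thesis by blast
    qed
    then show "Y \<in> {X. \<not> has_common_subseq m {..<d} X}"
      using X has_common_subseq_step[of m "{..<d}" Y "\<lambda>i. h i # X i" M] by blast
  qed (use bound C z in auto)
  also have "\<dots> = (\<Sum>i<d. C * ennreal ((1 / z) ^ \<nu> i) * (\<integral>\<^sup>+ b. ennreal (z ^ b) \<partial>L i))"
    by (simp add: measure_pmf.emeasure_space_1)
  also have "\<dots> = (\<Sum>i<d. C * ennreal (if h i = M then 1 else geometric_mgf (1 / real k) z) * ennreal ((1 / z) ^ \<nu> i))"
  proof (intro sum.cong refl)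
    fix i
    have "(\<integral>\<^sup>+ b. ennreal (z ^ b) \<partial>map_pmf Suc (geometric_pmf (1 / real k))) = ennreal (geometric_mgf (1 / real k) z)"
      unfolding geometric_mgf_def using k z by (intro nn_integral_geometric_pmf_power) auto
    then have "(\<integral>\<^sup>+ b. ennreal (z ^ b) \<partial>L i) = ennreal (if h i = M then 1 else geometric_mgf (1 / real k) z)"
      by (cases "h i = M") (simp_all add: L_def nn_integral_return_pmf)
    then show "C * ennreal ((1 / z) ^ \<nu> i) * (\<integral>\<^sup>+ b. ennreal (z ^ b) \<partial>L i) =
        C * ennreal (if h i = M then 1 else geometric_mgf (1 / real k) z) * ennreal ((1 / z) ^ \<nu> i)"
      by (simp only: mult_ac)
  qed
  finally show ?thesis .
qed

text \<open>Generating function of the number of letters that one string uses up in one greedy round.\<close>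

definition greedy_mgf :: "nat \<Rightarrow> nat \<Rightarrow> real \<Rightarrow> real" where
  "greedy_mgf k d z = geometric_mgf (2 / real k) z *
     (1 + disagreement d * (geometric_mgf (1 / real k) z - 1))"

lemma two_letter_rate_less_1:
  fixes z :: real
  assumes "z \<ge> 0" "(1 - 1 / real k) * z < 1"
  shows "(1 - 2 / real k) * z < 1"
proof -
  have "(1 - 2 / real k) * z \<le> (1 - 1 / real k) * z"
    using assms by (intro mult_right_mono) (auto simp: divide_right_mono)
  then show ?thesis using assms(2) by (rule le_less_trans)
qed

lemma greedy_mgf_ge_1:
  assumes "k \<ge> 2" "z \<ge> 1" "(1 - 1 / real k) * z < 1"
  shows "greedy_mgf k d z \<ge> 1"
proof -
  have "1 \<le> geometric_mgf (2 / real k) z"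
    using assms by (intro geometric_mgf_ge_1 two_letter_rate_less_1) auto
  moreover have "1 \<le> geometric_mgf (1 / real k) z"
    using assms by (intro geometric_mgf_ge_1) auto
  then have "1 \<le> 1 + disagreement d * (geometric_mgf (1 / real k) z - 1)"
    by (simp add: disagreement_def)
  ultimately have "1 * 1 \<le> greedy_mgf k d z"
    unfolding greedy_mgf_def by (intro mult_mono) auto
  then show ?thesis by simp
qed

text \<open>Each round multiplies the potential, the sum of \<open>(1 / z) ^ \<nu> i\<close>, by
  \<open>greedy_mgf\<close> on average. The first half searches for a letter in
  \<open>{1, 2}\<close> and reports the votes, the second fetches the majority letter. As the
  potential is a sum over strings, the dependence between votes enters only through the probability
  that one voter disagrees.\<close>

lemma emeasure_no_common_subseq:
  fixes z :: real
  assumes k: "k \<ge> 2" and z: "z \<ge> 1" "(1 - 1 / real k) * z < 1"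
  shows "emeasure (string_tuple k d \<nu>) {X. \<not> has_common_subseq m {..<d} X}
    \<le> (\<Sum>i<d. ennreal (greedy_mgf k d z ^ m) * ennreal ((1 / z) ^ \<nu> i))"
proof (induction m arbitrary: \<nu>)
  case 0
  have "{X :: nat \<Rightarrow> nat list. \<not> has_common_subseq 0 {..<d} X} = {}"
    by (auto simp: has_common_subseq_def)
  then show ?case by simp
next
  case (Suc m)
  let ?G = "greedy_mgf k d z" and ?\<beta> = "geometric_mgf (1 / real k) z"
  let ?c = "\<lambda>\<tau> i. ennreal (?G ^ m) * ennreal (if \<tau> i = majority d \<tau> then 1 else ?\<beta>)"
  have G: "?G ^ m \<ge> 1" using greedy_mgf_ge_1[OF k z] by (rule one_le_power)
  have \<beta>: "?\<beta> \<ge> 1" using z by (intro geometric_mgf_ge_1) auto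
  have z2: "(1 - 2 / real k) * z < 1" using z by (intro two_letter_rate_less_1) auto
  have mgf: "(\<integral>\<^sup>+ b. ennreal (z ^ b) \<partial>map_pmf Suc (geometric_pmf (2 / real k))) = ennreal (geometric_mgf (2 / real k) z)"
    unfolding geometric_mgf_def using k z z2 by (intro nn_integral_geometric_pmf_power) auto
  have "emeasure (string_tuple k d \<nu>) {X. \<not> has_common_subseq (Suc m) {..<d} X} \<le>
    (\<integral>\<^sup>+ \<tau>. (\<Sum>i<d. ?c \<tau> i * ennreal ((1 / z) ^ \<nu> i) *
        (\<integral>\<^sup>+ b. ennreal (z ^ b) \<partial>map_pmf Suc (geometric_pmf (2 / real k)))) \<partial>ballots d)"
  proof (unfold ballots_def, rule emeasure_string_tuple_advance[where f = "\<lambda>_. split_first {1, 2}"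
        and S' = "\<lambda>\<tau>. {X. \<not> has_common_subseq (Suc m) {..<d} (\<lambda>i. \<tau> i # X i)}"])
    fix i n :: nat
    show "map_pmf (split_first {1, 2}) (random_string k n) =
        bind_pmf (pmf_of_set {1, 2}) (\<lambda>t. bind_pmf (map_pmf Suc (geometric_pmf (2 / real k)))
        (\<lambda>b. if b \<le> n then map_pmf (\<lambda>x. Some (t, x)) (random_string k (n - b)) else return_pmf None))"
      using k by (subst split_first_random_string) auto
  next
    fix X :: "nat \<Rightarrow> nat list" and \<tau> Y
    assume X: "X \<in> {X. \<not> has_common_subseq (Suc m) {..<d} X}"
      and s: "\<forall>i<d. split_first {1, 2} (X i) = Some (\<tau> i, Y i)"
    \<comment> \<open>Vote plus remainder is a subsequence of the original string, so failure for
      the originals forces failure for these.\<close>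
    have "subseq (\<tau> i # Y i) (X i)" if i: "i < d" for i
    proof -
      obtain u where "X i = u @ \<tau> i # Y i"
        using s[rule_format, OF i] split_first_SomeD[of "{1, 2}" "X i" "\<tau> i" "Y i"] by auto
      then show ?thesis by (simp add: list_emb_append2)
    qed
    then show "Y \<in> {X. \<not> has_common_subseq (Suc m) {..<d} (\<lambda>i. \<tau> i # X i)}"
      using X unfolding has_common_subseq_def mem_Collect_eq lessThan_iff Ball_def
      by (meson subseq_order.trans)
  next
    fix \<tau> \<nu> :: "nat \<Rightarrow> nat"
    have "majority d \<tau> \<in> {1..k}" using k by (simp add: majority_def)
    then show "emeasure (string_tuple k d \<nu>) {X. \<not> has_common_subseq (Suc m) {..<d} (\<lambda>i. \<tau> i # X i)}
        \<le> (\<Sum>i<d. ?c \<tau> i * ennreal ((1 / z) ^ \<nu> i))"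
      using k z G Suc.IH by (intro emeasure_no_common_subseq_after_heads) auto
  next
    fix \<tau> :: "nat \<Rightarrow> nat" and i
    have "1 * 1 \<le> ?c \<tau> i"
      using G \<beta> by (intro mult_mono) auto
    then show "1 \<le> ?c \<tau> i" by simp
  qed (use z in auto)
  also have "\<dots> = (\<Sum>i<d. (\<integral>\<^sup>+ \<tau>. ennreal (if \<tau> i = majority d \<tau> then 1 else ?\<beta>) \<partial>ballots d) *
      (ennreal (?G ^ m) * ennreal ((1 / z) ^ \<nu> i) * ennreal (geometric_mgf (2 / real k) z)))"
    unfolding mgf by (subst nn_integral_sum) (auto simp: nn_integral_cmult nn_integral_multc mult_ac intro!: sum.cong)
  also have "\<dots> = (\<Sum>i<d. ennreal (?G ^ Suc m) * ennreal ((1 / z) ^ \<nu> i))"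
  proof (intro sum.cong refl)
    fix i assume i: "i \<in> {..<d}"
    have "(\<integral>\<^sup>+ \<tau>. ennreal (if \<tau> i = majority d \<tau> then 1 else ?\<beta>) \<partial>ballots d) =
        ennreal (measure_pmf.expectation (ballots d) (\<lambda>\<tau>. if \<tau> i = majority d \<tau> then 1 else ?\<beta>))"
      using \<beta> by (intro nn_integral_eq_integral integrable_ballots) auto
    also have "measure_pmf.expectation (ballots d) (\<lambda>\<tau>. if \<tau> i = majority d \<tau> then 1 else ?\<beta>) =
        measure_pmf.expectation (ballots d) (\<lambda>\<tau>. 1 + (?\<beta> - 1) * indicat_real {\<tau>. \<tau> i \<noteq> majority d \<tau>} \<tau>)"
      by (intro Bochner_Integration.integral_cong) auto
    also have "\<dots> = 1 + disagreement d * (?\<beta> - 1)"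
      using prob_disagreement[of i d] i
      by (simp add: expectation_ballots_add)
    finally have "(\<integral>\<^sup>+ \<tau>. ennreal (if \<tau> i = majority d \<tau> then 1 else ?\<beta>) \<partial>ballots d) =
      ennreal (1 + disagreement d * (?\<beta> - 1))" .
    moreover have "ennreal (?G ^ Suc m) = ennreal (?G ^ m) *
        (ennreal (geometric_mgf (2 / real k) z) * ennreal (1 + disagreement d * (?\<beta> - 1)))"
    proof -
      have "geometric_mgf (2 / real k) z \<ge> 0" "1 + disagreement d * (?\<beta> - 1) \<ge> 0"
        using \<beta> geometric_mgf_ge_1[OF z2 z(1)] by (simp_all add: disagreement_def)
      then have "ennreal ?G = ennreal (geometric_mgf (2 / real k) z) * ennreal (1 + disagreement d * (?\<beta> - 1))"
        by (simp only: greedy_mgf_def ennreal_mult)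
      moreover have "ennreal (?G ^ Suc m) = ennreal (?G ^ m) * ennreal ?G"
        using order.trans[OF zero_le_one greedy_mgf_ge_1[OF k z, of d]]
        by (simp add: ennreal_mult mult.commute)
      ultimately show ?thesis by simp
    qed
    ultimately show "(\<integral>\<^sup>+ \<tau>. ennreal (if \<tau> i = majority d \<tau> then 1 else ?\<beta>) \<partial>ballots d) *
      (ennreal (?G ^ m) * ennreal ((1 / z) ^ \<nu> i) * ennreal (geometric_mgf (2 / real k) z)) =
      ennreal (?G ^ Suc m) * ennreal ((1 / z) ^ \<nu> i)"
      by (simp only: mult_ac)
  qed
  finally show ?case .
qed

section \<open>From the failure probability to the lower bound on the constant\<close>

lemma tendsto_nat_floor_ratio:
  fixes s :: real
  assumes "s \<ge> 0"
  shows "(\<lambda>n. real (nat \<lfloor>s * real n\<rfloor>) / real n) \<longlonglongrightarrow> s"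
proof (rule tendsto_sandwich[where f = "\<lambda>n. s - 1 / real n" and h = "\<lambda>_. s"])
  show "(\<lambda>n. s - 1 / real n) \<longlonglongrightarrow> s"
    using tendsto_diff[OF tendsto_const lim_const_over_n[of 1]] by simp
  show "\<forall>\<^sub>F n in sequentially. s - 1 / real n \<le> real (nat \<lfloor>s * real n\<rfloor>) / real n"
    using eventually_gt_at_top[of 0]
  proof eventually_elim
    case (elim n)
    have "s * real n - 1 \<le> real (nat \<lfloor>s * real n\<rfloor>)"
      using assms by linarith
    then have "(s * real n - 1) / real n \<le> real (nat \<lfloor>s * real n\<rfloor>) / real n"
      by (rule divide_right_mono) simp
    then show ?case using elim by (simp add: diff_divide_distrib)
  qed
  show "\<forall>\<^sub>F n in sequentially. real (nat \<lfloor>s * real n\<rfloor>) / real n \<le> s"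
    using eventually_gt_at_top[of 0]
    by eventually_elim (use assms in \<open>simp add: divide_le_eq\<close>)
qed simp

text \<open>For \<open>m = \<theta> * n\<close> rounded down, the greedy strategy fails with
  probability at most \<open>d * q ^ n\<close>, where \<open>q < 1\<close> is exactly the hypothesis
  \<open>lt\<close>. Hence the expected LCS is at least \<open>m\<close> times a factor tending to
  1.\<close>

lemma chvatal_sankoff_ge:
  fixes z :: real
  assumes k: "k \<ge> 2" and d: "d > 0" and \<theta>: "\<theta> \<ge> 0"
    and z: "z \<ge> 1" "(1 - 1 / real k) * z < 1" and lt: "greedy_mgf k d z powr \<theta> < z"
  shows "\<theta> \<le> chvatal_sankoff k d"
proof -
  define G where "G = greedy_mgf k d z"
  define q where "q = G powr \<theta> / z"
  define m where "m n = nat \<lfloor>\<theta> * real n\<rfloor>" for n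
  have G: "G \<ge> 1" unfolding G_def by (rule greedy_mgf_ge_1[OF k z])
  have q: "0 \<le> q" "q < 1" using lt z by (simp_all add: q_def G_def)
  have k0: "k > 0" using k by simp
  have bound: "real (m n) / real n * (1 - real d * q ^ n) \<le> expected_LCS k d n / real n" for n
  proof -
    let ?R = "random_strings k d n" and ?N = "{X. \<not> has_common_subseq (m n) {..<d} X}"
    have int: "integrable ?R f" for f :: "_ \<Rightarrow> real"
      by (rule integrable_measure_pmf_finite[OF finite_support_random_strings[OF k0]])
    have "emeasure ?R ?N \<le> (\<Sum>i<d. ennreal (G ^ m n) * ennreal ((1 / z) ^ n))"
      unfolding random_strings_def G_def by (rule emeasure_no_common_subseq[OF k z])
    also have "\<dots> = ennreal (real d * (G ^ m n * (1 / z) ^ n))"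
      using G z by (simp add: ennreal_mult ennreal_of_nat_eq_real_of_nat)
    finally have "measure_pmf.prob ?R ?N \<le> real d * (G ^ m n * (1 / z) ^ n)"
      using G z by (simp add: measure_pmf.emeasure_eq_measure)
    also have "\<dots> \<le> real d * q ^ n"
    proof (rule mult_left_mono)
      have "real (m n) \<le> \<theta> * real n"
        unfolding m_def using \<theta> by simp
      then have "G powr real (m n) \<le> G powr (\<theta> * real n)"
        using G by (intro powr_mono) auto
      then have "G ^ m n \<le> (G powr \<theta>) ^ n"
        using G by (simp add: powr_realpow powr_powr[symmetric])
      then have "G ^ m n * (1 / z) ^ n \<le> (G powr \<theta>) ^ n * (1 / z) ^ n"
        using z by (intro mult_right_mono) auto
      then show "G ^ m n * (1 / z) ^ n \<le> q ^ n"
        by (simp add: q_def power_divide)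
    qed simp
    finally have prob: "measure_pmf.prob ?R ?N \<le> real d * q ^ n" .
    have "real (m n) * (1 - real d * q ^ n) \<le> real (m n) * (1 - measure_pmf.prob ?R ?N)"
      using prob by (intro mult_left_mono) auto
    also have "\<dots> = measure_pmf.expectation ?R (\<lambda>X. real (m n) * (1 - indicat_real ?N X))"
      by (simp add: Bochner_Integration.integral_diff[OF int int])
    also have "\<dots> \<le> expected_LCS k d n"
      unfolding expected_LCS_def
    proof (intro integral_mono int)
      fix X :: "nat \<Rightarrow> nat list"
      have "m n \<le> LCS {..<d} X" if "X \<notin> ?N"
        using that le_LCS_iff[of "{..<d}" "m n" X] d by force
      then show "real (m n) * (1 - indicat_real ?N X) \<le> real (LCS {..<d} X)"
        by (auto simp: indicator_def)
    qed
    finally have "real (m n) * (1 - real d * q ^ n) / real n \<le> expected_LCS k d n / real n"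
      by (rule divide_right_mono) simp
    then show ?thesis by simp
  qed
  have "(\<lambda>n. real (m n) / real n * (1 - real d * q ^ n)) \<longlonglongrightarrow> \<theta> * (1 - real d * 0)"
    unfolding m_def using q
    by (intro tendsto_intros tendsto_nat_floor_ratio[OF \<theta>] LIMSEQ_realpow_zero)
  then show ?thesis
    using bound by (intro LIMSEQ_le[OF _ expected_LCS_tendsto[OF k0 d]]) auto
qed

lemma greedy_mgf_1: "k > 0 \<Longrightarrow> greedy_mgf k d 1 = 1"
  by (simp add: greedy_mgf_def geometric_mgf_def)

text \<open>The derivative at 1 is the mean cost of a round: \<open>k/2\<close> letters to reach
  \<open>{1, 2}\<close>, and \<open>k\<close> more in case of disagreement.\<close>

lemma greedy_mgf_deriv:
  assumes "k > 0"
  shows "(greedy_mgf k d has_real_derivative real k * (1 / 2 + disagreement d)) (at 1)"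
  unfolding greedy_mgf_def[abs_def] using assms
  by (auto intro!: derivative_eq_intros geometric_mgf_deriv simp: geometric_mgf_def field_simps)

text \<open>One letter is gained per \<open>\<mu>\<close> letters read. For
  \<open>\<theta> < 1 / \<mu>\<close> the function \<open>g\<close> has negative slope
  \<open>\<theta> * \<mu> - 1\<close> at 1, so some \<open>z\<close> slightly above 1 satisfies the
  condition of \<open>chvatal_sankoff_ge\<close>.\<close>

lemma chvatal_sankoff_ge_inverse_mean:
  assumes k: "k \<ge> 2" and d: "d > 0"
  shows "1 / (real k * (1 / 2 + disagreement d)) \<le> chvatal_sankoff k d"
proof (rule dense_le)
  define \<mu> where "\<mu> = real k * (1 / 2 + disagreement d)"
  have \<mu>: "\<mu> > 0"
    unfolding \<mu>_def using k by (intro mult_pos_pos add_pos_nonneg) (auto simp: disagreement_def)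
  fix \<theta> assume "\<theta> < 1 / (real k * (1 / 2 + disagreement d))"
  then have "\<theta> < 1 / \<mu>" by (simp add: \<mu>_def)
  then have \<theta>\<mu>: "\<theta> * \<mu> < 1" using \<mu> by (simp add: pos_less_divide_eq)
  show "\<theta> \<le> chvatal_sankoff k d"
  proof (cases "\<theta> \<ge> 0")
    case False
    have "0 \<le> chvatal_sankoff k d"
      using k d by (intro LIMSEQ_le_const[OF expected_LCS_tendsto]) (auto simp: expected_LCS_def)
    with False show ?thesis by simp
  next
    case True
    define g where "g z = \<theta> * ln (greedy_mgf k d z) - ln z" for z
    have "(g has_real_derivative \<theta> * \<mu> - 1) (at 1)"
      unfolding g_def[abs_def] using k
      by (auto intro!: derivative_eq_intros greedy_mgf_deriv simp: greedy_mgf_1 \<mu>_def)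
    then obtain r where r: "r > 0" "\<And>h. 0 < h \<Longrightarrow> h < r \<Longrightarrow> g (1 + h) < g 1"
      using DERIV_neg_dec_right[of g "\<theta> * \<mu> - 1" 1] \<theta>\<mu> by auto
    have "0 < min r (1 / real k)" using r(1) k by simp
    then obtain h where h: "0 < h" "h < r" "h < 1 / real k"
      using dense[of 0 "min r (1 / real k)"] by auto
    have "(1 - 1 / real k) * (1 + h) = 1 - (1 / real k - h) - h / real k"
      by (simp add: algebra_simps add_divide_distrib)
    also have "\<dots> < 1"
    proof -
      have "0 < h / real k" using h k by simp
      with h show ?thesis by linarith
    qed
    finally have rate: "(1 - 1 / real k) * (1 + h) < 1" .
    have G: "greedy_mgf k d (1 + h) \<ge> 1" using k h rate by (intro greedy_mgf_ge_1) auto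
    have "g (1 + h) < 0"
      using r(2)[OF h(1,2)] k by (simp add: g_def greedy_mgf_1)
    then have "exp (\<theta> * ln (greedy_mgf k d (1 + h))) < exp (ln (1 + h))"
      by (simp only: exp_less_cancel_iff g_def)
    then have "greedy_mgf k d (1 + h) powr \<theta> < 1 + h"
      using G h by (simp add: powr_def)
    then show ?thesis
      using k d True h rate by (intro chvatal_sankoff_ge[where z = "1 + h"]) auto
  qed
qed

text \<open>The saving \<open>x\<close> in the mean cost passes to its reciprocal by
  \<open>(1 + x) * (1 - x) \<le> 1\<close>.\<close>

lemma chvatal_sankoff_lower:
  assumes k: "k \<ge> 2" and d: "d > 0"
  shows "1 / real k * (1 + (5 / 18) / sqrt (real d)) \<le> chvatal_sankoff k d"
proof -
  define x where "x = 5 / 18 / sqrt (real d)"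
  have "disagreement d \<ge> 0" by (simp add: disagreement_def)
  then have pos: "1 / 2 + disagreement d > 0" by simp
  have le: "1 / 2 + disagreement d \<le> 1 - x"
    using disagreement_le[OF d] by (simp add: x_def)
  have "x \<ge> 0" by (simp add: x_def)
  then have "(1 + x) * (1 / 2 + disagreement d) \<le> (1 + x) * (1 - x)"
    using le by (intro mult_left_mono) auto
  also have "\<dots> \<le> 1" by (simp add: algebra_simps)
  finally have "1 + x \<le> 1 / (1 / 2 + disagreement d)"
    using pos by (subst pos_le_divide_eq)
  then have "1 / real k * (1 + x) \<le> 1 / real k * (1 / (1 / 2 + disagreement d))"
    by (intro mult_left_mono) auto
  also have "\<dots> \<le> chvatal_sankoff k d"
    using chvatal_sankoff_ge_inverse_mean[OF k d] by simp
  finally show ?thesis by (simp add: x_def)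
qed

theorem theorem2:
  shows "\<exists>c0 c1 c2 :: real. c0 > 0 \<and> c1 > 0 \<and> c2 > 0 \<and>
    (\<forall>k d :: nat. k \<ge> 2 \<longrightarrow> d \<ge> 2 \<longrightarrow> real d \<ge> c0 * log 2 (real k) \<longrightarrow>
       1 / real k * (1 + c1 / sqrt (real d)) \<le> chvatal_sankoff k d \<and>
       chvatal_sankoff k d \<le> 1 / real k * (1 + c2 * sqrt (log 2 (real k) / real d)))"
  by (rule exI[of _ 16], rule exI[of _ "5 / 18"], rule exI[of _ 4])
     (use chvatal_sankoff_lower chvatal_sankoff_upper in auto)

end
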